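(* Let $\mathcal{H}_A,\mathcal{H}_B$ be finite-dimensional Hilbert spaces, $M_A,M_B$ Hermitian operators on $\mathcal{H}_A,\mathcal{H}_B$, and $M_{AB}=M_A\otimes1_B+1_A\otimes M_B$. Let $U$ be a unitary on $\mathcal{H}_A\otimes\mathcal{H}_B$ with $[M_{AB},U]=0$, and let $|\phi\rangle_B$ be a unit eigenvector of $M_B$ belonging to its maximal or its minimal eigenvalue, this eigenvalue being non-degenerate. Define the quantum channel $\tau$ on $\mathcal{H}_A$ by $\tau(\rho)=\mathrm{Tr}_B\big[U(\rho\otimes|\phi\rangle_B\langle\phi|)U^{\dagger}\big]$. Then $\tau$ is mixing if and only if $U$ has exactly one eigenvector, up to nonzero scalar multiples, of the product form $|\nu\rangle_A\otimes|\phi\rangle_B$.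
   Context: $\mathrm{Tr}_B$ is the partial trace over $\mathcal{H}_B$. A quantum channel $\tau$ on $\mathcal{H}_A$ is mixing if there is a density matrix $\rho_*$ with $\tau^n(\rho)\to\rho_*$ for every density matrix $\rho$ on $\mathcal{H}_A$. *)

theory Defs
  imports "HOL-Analysis.Analysis"
begin

text \<open>Finite-dimensional Hilbert spaces are modelled as complex^'n for a finite index type 'n;
  operators as complex^'n^'n. The tensor product H_A \<otimes> H_B is indexed by 'a \<times> 'b.\<close>

definition ctrans :: "complex^'n^'m \<Rightarrow> complex^'m^'n" where
  "ctrans A = (\<chi> i j. cnj (A $ j $ i))"

definition hermitian :: "complex^'n^'n \<Rightarrow> bool" where
  "hermitian A \<longleftrightarrow> ctrans A = A"

definition unitary :: "complex^'n^'n \<Rightarrow> bool" where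
  "unitary U \<longleftrightarrow> U ** ctrans U = mat 1 \<and> ctrans U ** U = mat 1"

definition kron :: "complex^'a::finite^'a \<Rightarrow> complex^'b::finite^'b \<Rightarrow> complex^('a \<times> 'b)^('a \<times> 'b)" where
  "kron A B = (\<chi> p q. A $ fst p $ fst q * B $ snd p $ snd q)"

definition vkron :: "complex^'a::finite \<Rightarrow> complex^'b::finite \<Rightarrow> complex^('a \<times> 'b)" where
  "vkron v w = (\<chi> p. v $ fst p * w $ snd p)"

text \<open>|v><w|\<close>
definition outer :: "complex^'n \<Rightarrow> complex^'n \<Rightarrow> complex^'n^'n" where
  "outer v w = (\<chi> i j. v $ i * cnj (w $ j))"

text \<open>Partial trace over the second factor H_B.\<close>
definition ptrace_B :: "complex^('a::finite \<times> 'b::finite)^('a \<times> 'b) \<Rightarrow> complex^'a^'a" where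
  "ptrace_B X = (\<chi> i j. \<Sum>k\<in>UNIV. X $ (i, k) $ (j, k))"

text \<open>Sesquilinear form <x|A|x>.\<close>
definition qform :: "complex^'n^'n \<Rightarrow> complex^'n \<Rightarrow> complex" where
  "qform A x = (\<Sum>i\<in>UNIV. cnj (x $ i) * (A *v x) $ i)"

definition density :: "complex^'n^'n \<Rightarrow> bool" where
  "density \<rho> \<longleftrightarrow> hermitian \<rho> \<and> (\<forall>x. 0 \<le> Re (qform \<rho> x)) \<and> trace \<rho> = 1"

definition mixing :: "(complex^'n^'n \<Rightarrow> complex^'n^'n) \<Rightarrow> bool" where
  "mixing \<tau> \<longleftrightarrow> (\<exists>\<rho>s. density \<rho>s \<and>
      (\<forall>\<rho>. density \<rho> \<longrightarrow> (\<lambda>n. (\<tau> ^^ n) \<rho>) \<longlonglongrightarrow> \<rho>s))"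

definition is_eigenvalue :: "complex^'n^'n \<Rightarrow> complex \<Rightarrow> bool" where
  "is_eigenvalue M \<mu> \<longleftrightarrow> (\<exists>v. v \<noteq> 0 \<and> M *v v = \<mu> *s v)"

definition is_eigenvector :: "complex^'n^'n \<Rightarrow> complex^'n \<Rightarrow> bool" where
  "is_eigenvector M v \<longleftrightarrow> v \<noteq> 0 \<and> (\<exists>\<mu>. M *v v = \<mu> *s v)"

end

theory Submission
  imports Defs "HOL-Computational_Algebra.Fundamental_Theorem_Algebra"
begin

text \<open>Since \<open>U\<close> commutes with the total Hamiltonian, energy is conserved; the environment
  starts in its ground state \<open>\<phi>\<close> and can only gain energy, so the system energy
  \<open>Re (tr (M\<^sub>A \<rho>))\<close> never increases under \<open>\<tau>\<close>. It stays constant only if \<open>U\<close> maps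
  \<open>\<nu> \<otimes> \<phi>\<close> to a product vector for every \<open>\<nu>\<close> in the support of the state. By LaSalle's
  invariance principle this holds along the whole orbit of every limit point \<open>\<sigma>\<close> of an orbit,
  which puts the support of \<open>\<sigma>\<close> into the largest \<open>U\<close>-invariant subspace of
  \<open>\<H>\<^sub>A \<otimes> \<phi>\<close>. That subspace contains a product eigenvector of \<open>U\<close>, and is spanned by it
  when the product eigenvector is unique; then \<open>\<sigma>\<close> is the pure state of that eigenvector,
  and compactness of the set of density matrices forces every orbit to converge. Conversely,
  each product eigenvector \<open>\<nu> \<otimes> \<phi>\<close> gives the fixed pure state of \<open>\<nu>\<close>, and the limit
  state of a mixing channel is a fixed point, which yields a product eigenvector. Negating both
  Hamiltonians turns a maximal eigenvalue into a minimal one.\<close>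

section \<open>Complex inner product\<close>

definition cinner :: "complex^'n \<Rightarrow> complex^'n \<Rightarrow> complex" where
  "cinner x y = (\<Sum>i\<in>UNIV. cnj (x$i) * y$i)"

lemma cinner_add_right: "cinner x (y + z) = cinner x y + cinner x z"
  by (simp add: cinner_def algebra_simps sum.distrib)

lemma cinner_add_left: "cinner (x + y) z = cinner x z + cinner y z"
  by (simp add: cinner_def algebra_simps sum.distrib)

lemma cinner_diff_right: "cinner x (y - z) = cinner x y - cinner x z"
  by (simp add: cinner_def algebra_simps sum_subtractf)

lemma cinner_scale_right: "cinner x (c *s y) = c * cinner x y"
  by (simp add: cinner_def sum_distrib_left algebra_simps)

lemma cinner_scale_left: "cinner (c *s x) y = cnj c * cinner x y"
  by (simp add: cinner_def sum_distrib_left algebra_simps)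

lemma cinner_zero_right [simp]: "cinner x 0 = 0"
  by (simp add: cinner_def)

lemma cinner_zero_left [simp]: "cinner 0 x = 0"
  by (simp add: cinner_def)

lemma cinner_sum_right: "cinner x (\<Sum>g\<in>F. f g) = (\<Sum>g\<in>F. cinner x (f g))"
  by (induction F rule: infinite_finite_induct) (auto simp: cinner_add_right)

lemma cinner_sum_left: "cinner (\<Sum>g\<in>F. f g) x = (\<Sum>g\<in>F. cinner (f g) x)"
  by (induction F rule: infinite_finite_induct) (auto simp: cinner_add_left)

lemma cinner_commute: "cinner y x = cnj (cinner x y)"
  by (simp add: cinner_def mult.commute)

lemma cnj_mult_self: "cnj z * z = of_real ((cmod z)^2)"
  by (metis complex_norm_square mult.commute of_real_power)

lemma norm_vec_square: "(norm (x::complex^'n))^2 = (\<Sum>i\<in>UNIV. (cmod (x$i))^2)"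
  by (simp add: norm_vec_def L2_set_def sum_nonneg)

lemma cinner_self: "cinner x x = of_real ((norm x)^2)"
  by (simp add: cinner_def norm_vec_square cnj_mult_self)

lemma cinner_self_eq_0 [simp]: "cinner x x = 0 \<longleftrightarrow> x = 0"
  by (simp add: cinner_self)

lemma norm_scale_vec: "norm (c *s (x::complex^'n)) = cmod c * norm x"
  by (simp add: norm_vec_def L2_set_def norm_mult power_mult_distrib
      sum_distrib_left[symmetric] real_sqrt_mult)

lemma ctrans_ctrans [simp]: "ctrans (ctrans A) = A"
  by (simp add: ctrans_def vec_eq_iff)

lemma cinner_adjoint: "cinner (A *v x) y = cinner x (ctrans A *v y)"
proof -
  have "cinner (A *v x) y = (\<Sum>i\<in>UNIV. \<Sum>j\<in>UNIV. cnj (A$i$j) * cnj (x$j) * y$i)"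
    unfolding cinner_def matrix_vector_mult_def
    by (auto simp: sum_distrib_right intro!: sum.cong)
  also have "\<dots> = (\<Sum>j\<in>UNIV. \<Sum>i\<in>UNIV. cnj (A$i$j) * cnj (x$j) * y$i)"
    by (rule sum.swap)
  also have "\<dots> = cinner x (ctrans A *v y)"
    unfolding cinner_def matrix_vector_mult_def ctrans_def
    by (auto simp: sum_distrib_left intro!: sum.cong)
  finally show ?thesis .
qed

lemma cinner_adjoint_right: "cinner x (A *v y) = cinner (ctrans A *v x) y"
  by (simp add: cinner_adjoint)

lemma hermitian_cinner_swap: "hermitian H \<Longrightarrow> cinner (H *v x) y = cinner x (H *v y)"
  by (simp add: hermitian_def cinner_adjoint)

lemma hermitian_Im_cinner: "hermitian H \<Longrightarrow> Im (cinner x (H *v x)) = 0"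
  by (metis cinner_commute cnj.sel(2) hermitian_cinner_swap neg_equal_zero)

lemma hermitian_eigenvalue_real:
  assumes "hermitian H" "H *v x = \<mu> *s x" "x \<noteq> 0"
  shows "\<mu> = of_real (Re \<mu>)"
proof -
  have "cinner x (H *v x) = \<mu> * cinner x x"
    using assms(2) by (simp add: cinner_scale_right)
  with hermitian_Im_cinner[OF assms(1), of x] assms(3) have "Im \<mu> = 0"
    by (simp add: cinner_self)
  then show ?thesis by (simp add: complex_eq_iff)
qed

lemma unitary_cinner: "unitary U \<Longrightarrow> cinner (U *v x) (U *v y) = cinner x y"
  by (simp add: unitary_def cinner_adjoint matrix_vector_mul_assoc)

lemma unitary_norm:
  assumes "unitary U"
  shows "norm (U *v x) = norm x"
proof -
  have "(norm (U *v x))^2 = (norm x)^2"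
    using unitary_cinner[OF assms, of x x] by (metis cinner_self of_real_eq_iff)
  then show ?thesis by (simp add: power2_eq_iff_nonneg)
qed

lemma unitary_eigenvalue_norm:
  assumes "unitary U" "U *v e = \<mu> *s e" "e \<noteq> 0"
  shows "cmod \<mu> = 1"
  using unitary_norm[OF assms(1), of e] assms(2,3) by (simp add: norm_scale_vec)

lemma unitary_adjoint_eigenvector:
  assumes "unitary U" "U *v e = \<mu> *s e" "e \<noteq> 0"
  shows "ctrans U *v e = cnj \<mu> *s e"
proof -
  have "e = ctrans U *v (U *v e)"
    using assms(1) by (simp add: unitary_def matrix_vector_mul_assoc)
  also have "\<dots> = \<mu> *s (ctrans U *v e)" using assms(2) by (simp add: vec.scale)
  finally have "cnj \<mu> *s e = (cnj \<mu> * \<mu>) *s (ctrans U *v e)"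
    by (metis vector_smult_assoc)
  with unitary_eigenvalue_norm[OF assms] show ?thesis by (simp add: cnj_mult_self)
qed


section \<open>Eigenvectors in invariant subspaces\<close>

definition poly_apply :: "complex poly \<Rightarrow> complex^'n^'n \<Rightarrow> complex^'n \<Rightarrow> complex^'n" where
  "poly_apply p A x = (\<Sum>k\<le>degree p. coeff p k *s ((*v) A ^^ k) x)"

lemma poly_apply_degree_le:
  assumes "degree p \<le> n"
  shows "poly_apply p A x = (\<Sum>k\<le>n. coeff p k *s ((*v) A ^^ k) x)"
  unfolding poly_apply_def
  by (rule sum.mono_neutral_left) (use assms in \<open>auto simp: coeff_eq_0\<close>)

lemma poly_apply_add: "poly_apply (p + q) A x = poly_apply p A x + poly_apply q A x"
proof -
  define n where "n = max (degree p) (degree q)"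
  have "poly_apply (p + q) A x = (\<Sum>k\<le>n. coeff (p + q) k *s ((*v) A ^^ k) x)"
    by (rule poly_apply_degree_le) (auto simp: n_def intro: degree_add_le)
  also have "\<dots> = poly_apply p A x + poly_apply q A x"
    by (subst (1 2) poly_apply_degree_le[of _ n])
       (auto simp: n_def sum.distrib vector_sadd_rdistrib)
  finally show ?thesis .
qed

lemma poly_apply_smult: "poly_apply (smult c p) A x = c *s poly_apply p A x"
  by (simp add: poly_apply_degree_le[of "smult c p" "degree p"] poly_apply_def
      vec.scale_sum_right vector_smult_assoc)

lemma poly_apply_pCons_0: "poly_apply (pCons 0 p) A x = A *v poly_apply p A x"
proof -
  have "poly_apply (pCons 0 p) A x
      = (\<Sum>k\<le>Suc (degree p). coeff (pCons 0 p) k *s ((*v) A ^^ k) x)"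
    by (rule poly_apply_degree_le) simp
  also have "\<dots> = (\<Sum>k\<le>degree p. coeff p k *s ((*v) A ^^ Suc k) x)"
    by (subst sum.atMost_Suc_shift) simp
  finally show ?thesis by (simp add: poly_apply_def vec.sum vec.scale)
qed

lemma poly_apply_linear_factor:
  "poly_apply ([:-r, 1:] * q) A x = A *v poly_apply q A x - r *s poly_apply q A x"
proof -
  have "[:-r, 1:] * q = smult (-r) q + pCons 0 q" by simp
  then have "poly_apply ([:-r, 1:] * q) A x = (-r) *s poly_apply q A x + A *v poly_apply q A x"
    by (simp only: poly_apply_add poly_apply_smult poly_apply_pCons_0)
  then show ?thesis by (simp add: vector_smult_lneg)
qed

lemma funpow_mult_in_invariant:
  assumes "\<forall>y\<in>S. A *v y \<in> S" "x \<in> S"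
  shows "((*v) A ^^ k) x \<in> S"
  using assms by (induction k) auto

lemma poly_apply_in_invariant_subspace:
  assumes "vec.subspace S" "\<forall>y\<in>S. A *v y \<in> S" "x \<in> S"
  shows "poly_apply p A x \<in> S"
  unfolding poly_apply_def
  by (intro vec.subspace_sum[OF assms(1)] vec.subspace_scale[OF assms(1)]
      funpow_mult_in_invariant[OF assms(2,3)])

text \<open>Factoring the annihilating polynomial into linear factors, the last factor that does not
  yet kill \<open>x\<close> leaves an eigenvector behind.\<close>

lemma invariant_subspace_eigenvector_if_annihilated:
  assumes "vec.subspace S" "\<forall>y\<in>S. A *v y \<in> S" "x \<in> S" "x \<noteq> 0"
    and "p \<noteq> 0" "poly_apply p A x = 0"
  shows "\<exists>y\<in>S. y \<noteq> 0 \<and> (\<exists>\<mu>. A *v y = \<mu> *s y)"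
  using assms(5,6)
proof (induction "degree p" arbitrary: p rule: less_induct)
  case less
  show ?case
  proof (cases "degree p = 0")
    case True
    then have "coeff p 0 \<noteq> 0"
      using less.prems(1) leading_coeff_0_iff by fastforce
    moreover have "coeff p 0 *s x = 0"
      using less.prems(2) True by (simp add: poly_apply_def)
    ultimately show ?thesis using assms(4) by simp
  next
    case False
    then have "\<not> constant (poly p)" by (simp add: constant_degree)
    then obtain r where "poly p r = 0" using fundamental_theorem_of_algebra by blast
    then obtain q where pq: "p = [:-r, 1:] * q"
      by (metis dvdE poly_eq_0_iff_dvd)
    with less.prems(1) have "q \<noteq> 0" by auto
    then have deg_q: "degree q < degree p"
      unfolding pq by (subst degree_mult_eq) auto
    show ?thesis
    proof (cases "poly_apply q A x = 0")
      case True
      then show ?thesis using less.hyps[OF deg_q \<open>q \<noteq> 0\<close>] by blast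
    next
      case False
      moreover have "poly_apply q A x \<in> S"
        by (rule poly_apply_in_invariant_subspace[OF assms(1-3)])
      moreover have "A *v poly_apply q A x - r *s poly_apply q A x = 0"
        using less.prems(2) unfolding pq poly_apply_linear_factor .
      then have "A *v poly_apply q A x = r *s poly_apply q A x" by simp
      ultimately show ?thesis by blast
    qed
  qed
qed

lemma vec_family_dependent:
  fixes f :: "nat \<Rightarrow> complex^'n"
  shows "\<exists>c. (\<exists>k\<le>CARD('n). c k \<noteq> 0) \<and> (\<Sum>k\<le>CARD('n). c k *s f k) = 0"
proof (cases "inj_on f {..CARD('n)}")
  case True
  define S where "S = f ` {..CARD('n)}"
  have "vec.dim S \<le> CARD('n)"
    using vec.dim_subset_UNIV[of S] by (simp add: vec.dimension_def card_cart_basis)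
  with True have "vec.dependent S"
    by (intro vec.dependent_biggerset_general) (simp add: S_def card_image)
  then obtain c where c: "(\<Sum>v\<in>S. c v *s v) = 0" "\<exists>v\<in>S. c v \<noteq> 0"
    using vec.independent_explicit[of S] by (auto simp: S_def)
  have "(\<Sum>k\<le>CARD('n). c (f k) *s f k) = 0"
    using c(1) True by (simp add: S_def sum.reindex)
  with c(2) show ?thesis by (auto simp: S_def)
next
  case False
  then obtain i j where ij: "i \<le> CARD('n)" "j \<le> CARD('n)" "i \<noteq> j" "f i = f j"
    by (auto simp: inj_on_def)
  define c where "c k = (if k = i then 1 else if k = j then -1 else 0 :: complex)" for k
  have "(\<Sum>k\<le>CARD('n). c k *s f k)
      = (\<Sum>k\<le>CARD('n). (if k = i then f i else 0) - (if k = j then f j else 0))"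
    using ij(3) by (intro sum.cong) (auto simp: c_def vector_smult_lneg)
  also have "\<dots> = 0" using ij by (simp add: sum_subtractf sum.delta)
  finally have "(\<Sum>k\<le>CARD('n). c k *s f k) = 0" .
  moreover have "c i \<noteq> 0" by (simp add: c_def)
  ultimately show ?thesis using ij(1) by blast
qed

lemma exists_annihilating_poly: "\<exists>p. p \<noteq> 0 \<and> poly_apply p A (x::complex^'n) = 0"
proof -
  obtain c where c: "\<exists>k\<le>CARD('n). c k \<noteq> 0" "(\<Sum>k\<le>CARD('n). c k *s ((*v) A ^^ k) x) = 0"
    using vec_family_dependent[of "\<lambda>k. ((*v) A ^^ k) x"] by blast
  define p where "p = (\<Sum>k\<le>CARD('n). monom (c k) k)"
  have coeff_p: "coeff p k = c k" if "k \<le> CARD('n)" for k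
    using that by (simp add: p_def coeff_sum)
  have "degree (monom (c k) k) \<le> CARD('n)" if "k \<in> {..CARD('n)}" for k
    using that degree_monom_le[of "c k" k] by simp
  then have "degree p \<le> CARD('n)"
    unfolding p_def by (rule degree_sum_le[OF finite_atMost])
  then have "poly_apply p A x = (\<Sum>k\<le>CARD('n). c k *s ((*v) A ^^ k) x)"
    unfolding poly_apply_degree_le[OF \<open>degree p \<le> CARD('n)\<close>]
    by (intro sum.cong refl) (simp add: coeff_p)
  with c(2) have "poly_apply p A x = 0" by simp
  moreover obtain k where "k \<le> CARD('n)" "c k \<noteq> 0" using c(1) by blast
  then have "p \<noteq> 0" using coeff_p by (metis coeff_0)
  ultimately show ?thesis by blast
qed

lemma invariant_subspace_has_eigenvector:
  fixes A :: "complex^'n^'n"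
  assumes "vec.subspace S" "\<forall>y\<in>S. A *v y \<in> S" "x \<in> S" "x \<noteq> 0"
  shows "\<exists>y\<in>S. y \<noteq> 0 \<and> (\<exists>\<mu>. A *v y = \<mu> *s y)"
proof -
  obtain p where "p \<noteq> 0" "poly_apply p A x = 0"
    using exists_annihilating_poly by blast
  then show ?thesis by (rule invariant_subspace_eigenvector_if_annihilated[OF assms])
qed

section \<open>Spectral theorem for Hermitian matrices\<close>

definition orthonormal :: "(complex^'n) set \<Rightarrow> bool" where
  "orthonormal F \<longleftrightarrow> (\<forall>g\<in>F. cinner g g = 1) \<and> (\<forall>g\<in>F. \<forall>h\<in>F. g \<noteq> h \<longrightarrow> cinner g h = 0)"

lemma orthonormal_cinner_sum:
  assumes "orthonormal F" "finite F" "h \<in> F"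
  shows "cinner h (\<Sum>g\<in>F. b g *s g) = b h"
proof -
  have "cinner h (\<Sum>g\<in>F. b g *s g) = (\<Sum>g\<in>F. if g = h then b g else 0)"
    using assms(1,3) unfolding orthonormal_def
    by (auto simp: cinner_sum_right cinner_scale_right intro!: sum.cong)
  also have "\<dots> = b h" using assms(2,3) by simp
  finally show ?thesis .
qed

lemma orthonormal_cinner_sums:
  assumes "orthonormal F" "finite F"
  shows "cinner (\<Sum>g\<in>F. a g *s g) (\<Sum>g\<in>F. b g *s g) = (\<Sum>g\<in>F. cnj (a g) * b g)"
  using orthonormal_cinner_sum[OF assms] by (simp add: cinner_sum_left cinner_scale_left)

lemma orthonormal_norm:
  assumes "orthonormal F" "g \<in> F"
  shows "norm g = 1"
proof -
  have "cinner g g = 1" using assms by (simp add: orthonormal_def)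
  then have "(norm g)^2 = 1" by (metis cinner_self of_real_eq_1_iff)
  then show ?thesis using power2_eq_iff_nonneg[of "norm g" 1] by simp
qed

lemma orthonormal_nonzero: "orthonormal F \<Longrightarrow> g \<in> F \<Longrightarrow> g \<noteq> 0"
  by (auto simp: orthonormal_def)

lemma orthonormal_independent:
  assumes "orthonormal F"
  shows "vec.independent F"
proof
  assume "vec.dependent F"
  then obtain t u where t: "finite t" "t \<subseteq> F" "(\<Sum>v\<in>t. u v *s v) = 0" "\<exists>v\<in>t. u v \<noteq> 0"
    unfolding vec.dependent_explicit by blast
  have "orthonormal t" using assms t(2) unfolding orthonormal_def by blast
  from t(4) obtain v where "v \<in> t" "u v \<noteq> 0" by blast
  with t(3) orthonormal_cinner_sum[OF \<open>orthonormal t\<close> t(1) \<open>v \<in> t\<close>, of u]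
  show False by simp
qed

lemma orthonormal_card_le:
  fixes F :: "(complex^'n) set"
  assumes "orthonormal F"
  shows "finite F \<and> card F \<le> CARD('n)"
proof -
  have "finite F \<and> card F \<le> vec.dim F"
    using vec.independent_bound_general[OF orthonormal_independent[OF assms]] .
  moreover have "vec.dim F \<le> CARD('n)"
    using vec.dim_subset_UNIV[of F] by (simp add: vec.dimension_def card_cart_basis)
  ultimately show ?thesis by linarith
qed

lemma cinner_normalize_self:
  assumes "e \<noteq> 0"
  shows "cinner (of_real (1 / norm e) *s e) (of_real (1 / norm e) *s e) = 1"
proof -
  have "cinner (of_real (1 / norm e) *s e) (of_real (1 / norm e) *s e)
      = of_real (1 / norm e) * of_real (1 / norm e) * cinner e e"
    by (simp add: cinner_scale_left cinner_scale_right)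
  also have "\<dots> = 1" using assms by (simp add: cinner_self power2_eq_square)
  finally show ?thesis .
qed

text \<open>The orthogonal complement of a family of eigenvectors of a Hermitian matrix is invariant,
  so it contains a further eigenvector as long as it is nonzero.\<close>

lemma hermitian_extend_orthonormal_eigenvectors:
  assumes herm: "hermitian H" and orth: "orthonormal F" "finite F"
    and eig: "\<forall>g\<in>F. \<exists>\<mu>. H *v g = \<mu> *s g"
    and x: "x \<noteq> (\<Sum>g\<in>F. cinner g x *s g)"
  shows "\<exists>e. e \<notin> F \<and> orthonormal (insert e F) \<and> (\<exists>\<mu>. H *v e = \<mu> *s e)"
proof -
  define S where "S = {y. \<forall>g\<in>F. cinner g y = 0}"
  have "vec.subspace S"
    unfolding S_def vec.subspace_def by (auto simp: cinner_add_right cinner_scale_right)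
  moreover have "\<forall>y\<in>S. H *v y \<in> S"
  proof (intro ballI, unfold S_def mem_Collect_eq, intro ballI)
    fix y g assume "\<forall>g\<in>F. cinner g y = 0" "g \<in> F"
    moreover obtain \<mu> where "H *v g = \<mu> *s g" using eig \<open>g \<in> F\<close> by blast
    ultimately show "cinner g (H *v y) = 0"
      by (simp add: cinner_scale_left flip: hermitian_cinner_swap[OF herm])
  qed
  moreover have "x - (\<Sum>g\<in>F. cinner g x *s g) \<in> S"
    using orthonormal_cinner_sum[OF orth] by (simp add: S_def cinner_diff_right)
  moreover have "x - (\<Sum>g\<in>F. cinner g x *s g) \<noteq> 0" using x by simp
  ultimately obtain y \<mu> where y: "y \<in> S" "y \<noteq> 0" "H *v y = \<mu> *s y"
    using invariant_subspace_has_eigenvector by blast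
  define e where "e = of_real (1 / norm y) *s y"
  have "cinner e e = 1" unfolding e_def by (rule cinner_normalize_self[OF y(2)])
  moreover have perp: "\<forall>g\<in>F. cinner g e = 0"
    using y(1) by (simp add: e_def S_def cinner_scale_right)
  moreover have "\<forall>g\<in>F. cinner e g = 0"
    using perp by (metis cinner_commute complex_cnj_zero)
  ultimately have "e \<notin> F" "orthonormal (insert e F)"
    using orth(1) by (auto simp: orthonormal_def)
  moreover have "H *v e = \<mu> *s e"
    using y(3) by (simp add: e_def vec.scale vector_smult_assoc mult.commute)
  ultimately show ?thesis by blast
qed

theorem hermitian_orthonormal_eigenbasis:
  fixes H :: "complex^'n^'n"
  assumes herm: "hermitian H"
  obtains F ev where "finite F" "orthonormal F" "\<forall>g\<in>F. H *v g = of_real (ev g) *s g"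
    "\<forall>x. x = (\<Sum>g\<in>F. cinner g x *s g)"
proof -
  define P where "P F \<longleftrightarrow> orthonormal F \<and> (\<forall>g\<in>F. \<exists>\<mu>. H *v g = \<mu> *s g)"
    for F :: "(complex^'n) set"
  have "P {}" by (simp add: P_def orthonormal_def)
  moreover have "\<forall>F. P F \<longrightarrow> card F < Suc CARD('n)"
    by (metis P_def orthonormal_card_le le_imp_less_Suc)
  ultimately obtain F where F: "P F" and F_max: "\<And>G. P G \<Longrightarrow> card G \<le> card F"
    using ex_has_greatest_nat[of P "{}" card] by blast
  have orth: "orthonormal F" and eig: "\<forall>g\<in>F. \<exists>\<mu>. H *v g = \<mu> *s g"
    using F by (auto simp: P_def)
  have fin: "finite F" using orthonormal_card_le[OF orth] by simp
  have expansion: "\<forall>x. x = (\<Sum>g\<in>F. cinner g x *s g)"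
  proof (rule allI, rule ccontr)
    fix x
    assume "x \<noteq> (\<Sum>g\<in>F. cinner g x *s g)"
    then obtain e where "e \<notin> F" "orthonormal (insert e F)" "\<exists>\<mu>. H *v e = \<mu> *s e"
      using hermitian_extend_orthonormal_eigenvectors[OF herm orth fin eig] by blast
    then have "e \<notin> F" "P (insert e F)" using eig by (auto simp: P_def)
    with F_max[of "insert e F"] fin show False by simp
  qed
  moreover have "\<forall>g\<in>F. H *v g = of_real (Re (cinner g (H *v g))) *s g"
  proof
    fix g assume "g \<in> F"
    then obtain \<mu> where "H *v g = \<mu> *s g" using eig by blast
    moreover have "cinner g (H *v g) = \<mu>"
      using calculation orth \<open>g \<in> F\<close> by (simp add: cinner_scale_right orthonormal_def)
    ultimately show "H *v g = of_real (Re (cinner g (H *v g))) *s g"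
      using hermitian_eigenvalue_real[OF herm] orthonormal_nonzero[OF orth \<open>g \<in> F\<close>] by metis
  qed
  ultimately show ?thesis
    using that[OF fin orth, of "\<lambda>g. Re (cinner g (H *v g))"] by blast
qed

lemma eigenbasis_mult:
  assumes "\<forall>x. x = (\<Sum>g\<in>F. cinner g x *s g)" "\<forall>g\<in>F. H *v g = of_real (ev g) *s g"
  shows "H *v x = (\<Sum>g\<in>F. (of_real (ev g) * cinner g x) *s g)"
proof -
  have "H *v x = H *v (\<Sum>g\<in>F. cinner g x *s g)" using assms(1) by metis
  also have "\<dots> = (\<Sum>g\<in>F. (of_real (ev g) * cinner g x) *s g)"
    using assms(2) by (simp add: vec.sum vec.scale vector_smult_assoc mult.commute)
  finally show ?thesis .
qed

lemma hermitian_eigenvalue_lower_bound: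
  fixes H :: "complex^'n^'n"
  assumes herm: "hermitian H" and lower: "\<forall>\<mu>. is_eigenvalue H \<mu> \<longrightarrow> m \<le> Re \<mu>"
  shows hermitian_cinner_ge_eigenvalue_bound: "m * (norm z)^2 \<le> Re (cinner z (H *v z))"
    and hermitian_cinner_eq_eigenvalue_bound:
      "Re (cinner z (H *v z)) = m * (norm z)^2 \<Longrightarrow> H *v z = of_real m *s z"
proof -
  obtain F ev where F: "finite F" "orthonormal F" "\<forall>g\<in>F. H *v g = of_real (ev g) *s g"
      "\<forall>x. x = (\<Sum>g\<in>F. cinner g x *s g)"
    using hermitian_orthonormal_eigenbasis[OF herm] by blast
  define c where "c g = cinner g z" for g
  have z: "z = (\<Sum>g\<in>F. c g *s g)" using F(4) by (simp add: c_def)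
  have Hz: "H *v z = (\<Sum>g\<in>F. (of_real (ev g) * c g) *s g)"
    using eigenbasis_mult[OF F(4,3)] by (simp add: c_def)
  have "cinner z (H *v z) = (\<Sum>g\<in>F. cnj (c g) * (of_real (ev g) * c g))"
    unfolding Hz by (subst z) (rule orthonormal_cinner_sums[OF F(2,1)])
  also have "\<dots> = (\<Sum>g\<in>F. of_real (ev g) * (cnj (c g) * c g))"
    by (simp add: mult_ac)
  finally have "cinner z (H *v z) = of_real (\<Sum>g\<in>F. ev g * (cmod (c g))^2)"
    by (simp add: cnj_mult_self)
  then have Re_Hz: "Re (cinner z (H *v z)) = (\<Sum>g\<in>F. ev g * (cmod (c g))^2)"
    by (metis Re_complex_of_real)
  have "cinner z z = of_real (\<Sum>g\<in>F. (cmod (c g))^2)"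
    by (subst (1 2) z) (simp add: orthonormal_cinner_sums[OF F(2,1)] cnj_mult_self)
  then have norm_z: "(norm z)^2 = (\<Sum>g\<in>F. (cmod (c g))^2)"
    by (metis cinner_self of_real_eq_iff)
  have diff: "Re (cinner z (H *v z)) - m * (norm z)^2 = (\<Sum>g\<in>F. (ev g - m) * (cmod (c g))^2)"
    by (simp add: Re_Hz norm_z sum_distrib_left sum_subtractf algebra_simps)
  have ev_ge: "m \<le> ev g" if "g \<in> F" for g
    using lower F(3) that orthonormal_nonzero[OF F(2) that] by (force simp: is_eigenvalue_def)
  then have terms: "\<forall>g\<in>F. 0 \<le> (ev g - m) * (cmod (c g))^2" by simp
  then have "0 \<le> (\<Sum>g\<in>F. (ev g - m) * (cmod (c g))^2)" by (simp add: sum_nonneg)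
  then show "m * (norm z)^2 \<le> Re (cinner z (H *v z))" using diff by linarith
  assume "Re (cinner z (H *v z)) = m * (norm z)^2"
  with diff terms have "\<forall>g\<in>F. (ev g - m) * (cmod (c g))^2 = 0"
    using sum_nonneg_eq_0_iff[OF F(1)] by (metis (no_types, lifting) right_minus_eq)
  then have "\<forall>g\<in>F. of_real (ev g) * c g = of_real m * c g" by auto
  then have "H *v z = (\<Sum>g\<in>F. (of_real m * c g) *s g)"
    unfolding Hz by (intro sum.cong refl) simp
  also have "\<dots> = of_real m *s z" by (subst z) (simp add: vec.scale_sum_right vector_smult_assoc)
  finally show "H *v z = of_real m *s z" .
qed

section \<open>Density matrices\<close>

lemma outer_mult: "outer u v *v x = cinner v x *s u"
  by (simp add: outer_def matrix_vector_mult_def cinner_def vec_eq_iff sum_distrib_left mult_ac)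

lemma outer_scale: "outer (c *s v) (c *s v) = (cmod c)^2 *\<^sub>R outer v v"
  by (simp add: outer_def vec_eq_iff)
     (simp add: scaleR_conv_of_real mult_ac flip: cnj_mult_self del: of_real_power)

lemma trace_mult_outer: "trace (A ** outer v v) = cinner v (A *v v)"
  by (simp add: trace_def matrix_matrix_mult_def outer_def cinner_def matrix_vector_mult_def
      sum_distrib_left mult_ac)

lemma matrix_scaleR_nth: "(c *\<^sub>R (A::complex^'n^'m)) $ i $ j = of_real c * A $ i $ j"
  by (simp only: vector_scaleR_component) (simp add: scaleR_conv_of_real)

lemma trace_scaleR: "trace (c *\<^sub>R (A::complex^'n^'n)) = of_real c * trace A"
  by (simp add: trace_def sum_distrib_left) (simp add: scaleR_conv_of_real)

definition mixture :: "'j set \<Rightarrow> ('j \<Rightarrow> real) \<Rightarrow> ('j \<Rightarrow> complex^'n) \<Rightarrow> complex^'n^'n" where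
  "mixture J w v = (\<Sum>j\<in>J. w j *\<^sub>R outer (v j) (v j))"

lemma mixture_nth: "mixture J w v $ i $ k = (\<Sum>j\<in>J. of_real (w j) * (v j $ i * cnj (v j $ k)))"
  unfolding mixture_def
  by (simp only: sum_component vector_scaleR_component) (simp add: outer_def scaleR_conv_of_real)

lemma mixture_mult: "mixture J w v *v x = (\<Sum>j\<in>J. (of_real (w j) * cinner (v j) x) *s v j)"
proof -
  have "(mixture J w v *v x) $ i = (\<Sum>j\<in>J. (of_real (w j) * cinner (v j) x) *s v j) $ i" for i
  proof -
    have "(mixture J w v *v x) $ i
        = (\<Sum>k\<in>UNIV. \<Sum>j\<in>J. of_real (w j) * (v j $ i * cnj (v j $ k)) * x $ k)"
      by (simp add: matrix_vector_mult_def mixture_nth sum_distrib_right)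
    also have "\<dots> = (\<Sum>j\<in>J. \<Sum>k\<in>UNIV. of_real (w j) * (v j $ i * cnj (v j $ k)) * x $ k)"
      by (rule sum.swap)
    also have "\<dots> = (\<Sum>j\<in>J. (of_real (w j) * cinner (v j) x) *s v j) $ i"
      by (simp add: sum_component cinner_def sum_distrib_left sum_distrib_right mult_ac)
    finally show ?thesis .
  qed
  then show ?thesis by (simp add: vec_eq_iff)
qed

lemma cinner_mixture: "cinner x (mixture J w v *v x) = of_real (\<Sum>j\<in>J. w j * (cmod (cinner (v j) x))^2)"
proof -
  have "cinner x (mixture J w v *v x) = (\<Sum>j\<in>J. of_real (w j) * (cinner x (v j) * cinner (v j) x))"
    by (simp add: mixture_mult cinner_sum_right cinner_scale_right mult_ac)
  also have "\<dots> = (\<Sum>j\<in>J. of_real (w j * (cmod (cinner (v j) x))^2))"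
    by (intro sum.cong refl) (simp add: cinner_commute[of x] cnj_mult_self)
  finally show ?thesis by simp
qed

lemma hermitian_mixture: "hermitian (mixture J w v)"
  by (simp add: hermitian_def ctrans_def vec_eq_iff mixture_nth mult_ac)

lemma trace_mixture: "trace (mixture J w v) = of_real (\<Sum>j\<in>J. w j * (norm (v j))^2)"
proof -
  have "trace (mixture J w v) = (\<Sum>j\<in>J. of_real (w j) * cinner (v j) (v j))"
    by (simp add: trace_def mixture_nth cinner_def sum_distrib_left mult_ac sum.swap[of _ UNIV])
  also have "\<dots> = of_real (\<Sum>j\<in>J. w j * (norm (v j))^2)" by (simp add: cinner_self)
  finally show ?thesis .
qed

lemma density_mixture:
  assumes "\<forall>j\<in>J. 0 \<le> w j" "(\<Sum>j\<in>J. w j * (norm (v j))^2) = 1"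
  shows "density (mixture J w v)"
  unfolding density_def
proof (intro conjI allI)
  show "hermitian (mixture J w v)" by (rule hermitian_mixture)
  show "trace (mixture J w v) = 1" using assms(2) by (simp add: trace_mixture)
  fix x
  show "0 \<le> Re (qform (mixture J w v) x)"
    using assms(1) by (simp add: qform_def cinner_mixture sum_nonneg flip: cinner_def)
qed

lemma mixture_kernel:
  assumes "finite J" "\<forall>j\<in>J. 0 \<le> w j" "mixture J w v *v y = 0" "j \<in> J" "w j > 0"
  shows "cinner (v j) y = 0"
proof -
  have "(\<Sum>j\<in>J. w j * (cmod (cinner (v j) y))^2) = 0"
    using cinner_mixture[of y J w v] assms(3) by (metis cinner_zero_right of_real_eq_0_iff)
  then have "\<forall>j\<in>J. w j * (cmod (cinner (v j) y))^2 = 0"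
    using assms(1,2) by (subst sum_nonneg_eq_0_iff[symmetric]) auto
  with assms(4,5) show ?thesis by auto
qed

lemma density_spectral_decomposition:
  fixes \<rho> :: "complex^'n^'n"
  assumes "density \<rho>"
  obtains F p where "finite F" "orthonormal F" "\<forall>g\<in>F. 0 \<le> p g" "\<rho> = mixture F p id"
    "(\<Sum>g\<in>F. p g) = 1" "\<forall>g\<in>F. \<rho> *v g = of_real (p g) *s g"
    "\<forall>x. x = (\<Sum>g\<in>F. cinner g x *s g)"
proof -
  have herm: "hermitian \<rho>" and psd: "\<forall>x. 0 \<le> Re (cinner x (\<rho> *v x))" and tr: "trace \<rho> = 1"
    using assms by (auto simp: density_def qform_def cinner_def)
  obtain F p where F: "finite F" "orthonormal F" "\<forall>g\<in>F. \<rho> *v g = of_real (p g) *s g"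
      "\<forall>x. x = (\<Sum>g\<in>F. cinner g x *s g)"
    using hermitian_orthonormal_eigenbasis[OF herm] by blast
  have p_nonneg: "\<forall>g\<in>F. 0 \<le> p g"
  proof
    fix g assume "g \<in> F"
    then have "cinner g (\<rho> *v g) = of_real (p g)"
      using F(2,3) by (simp add: cinner_scale_right orthonormal_def)
    then show "0 \<le> p g" using psd by (metis Re_complex_of_real)
  qed
  have \<rho>: "\<rho> = mixture F p id"
    by (rule matrix_eq[THEN iffD2], intro allI)
       (simp add: eigenbasis_mult[OF F(4,3)] mixture_mult)
  have "of_real (\<Sum>g\<in>F. p g) = (1::complex)"
    using tr trace_mixture[of F p id] orthonormal_norm[OF F(2)] by (simp add: \<rho>)
  then have "(\<Sum>g\<in>F. p g) = 1" by (metis of_real_eq_1_iff)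
  with that F p_nonneg \<rho> show ?thesis by blast
qed

lemma bounded_linear_ctrans: "bounded_linear (ctrans :: complex^'n^'n \<Rightarrow> complex^'n^'n)"
  unfolding linear_conv_bounded_linear[symmetric]
  by (rule linearI) (simp_all add: ctrans_def vec_eq_iff matrix_scaleR_nth)

lemma bounded_linear_trace: "bounded_linear (trace :: complex^'n^'n \<Rightarrow> complex)"
  unfolding linear_conv_bounded_linear[symmetric]
  by (rule linearI) (simp_all add: trace_add trace_scaleR, simp add: scaleR_conv_of_real)

lemma bounded_linear_Re_qform: "bounded_linear (\<lambda>\<rho>::complex^'n^'n. Re (qform \<rho> x))"
  unfolding linear_conv_bounded_linear[symmetric]
  by (rule linearI) (simp_all add: qform_def matrix_scaleR_nth matrix_vector_mult_def sum.distrib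
      distrib_left distrib_right sum_distrib_left mult_ac Re_sum)

lemma density_limit:
  fixes X :: "nat \<Rightarrow> complex^'n^'n"
  assumes "\<forall>n. density (X n)" "X \<longlonglongrightarrow> \<sigma>"
  shows "density \<sigma>"
  unfolding density_def
proof (intro conjI allI)
  have "(\<lambda>n. ctrans (X n)) \<longlonglongrightarrow> ctrans \<sigma>"
    by (rule bounded_linear.tendsto[OF bounded_linear_ctrans assms(2)])
  moreover have "(\<lambda>n. ctrans (X n)) = X"
    using assms(1) by (simp add: density_def hermitian_def fun_eq_iff)
  ultimately show "hermitian \<sigma>" using assms(2) LIMSEQ_unique by (auto simp: hermitian_def)
  have "(\<lambda>n. trace (X n)) \<longlonglongrightarrow> trace \<sigma>"
    by (rule bounded_linear.tendsto[OF bounded_linear_trace assms(2)])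
  moreover have "(\<lambda>n. trace (X n)) = (\<lambda>n. 1)" using assms(1) by (simp add: density_def fun_eq_iff)
  ultimately show "trace \<sigma> = 1" using LIMSEQ_const_iff by metis
  fix x
  have "(\<lambda>n. Re (qform (X n) x)) \<longlonglongrightarrow> Re (qform \<sigma> x)"
    by (rule bounded_linear.tendsto[OF bounded_linear_Re_qform assms(2)])
  moreover have "\<forall>n. 0 \<le> Re (qform (X n) x)" using assms(1) by (simp add: density_def)
  ultimately show "0 \<le> Re (qform \<sigma> x)" by (meson LIMSEQ_le_const)
qed

lemma norm_vec_le_sum: "norm (x::'a::real_normed_vector^'n) \<le> (\<Sum>i\<in>UNIV. norm (x$i))"
  unfolding norm_vec_def by (rule L2_set_le_sum) simp

lemma density_entry_bound:
  assumes "density \<rho>"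
  shows "norm (\<rho> $ i $ j) \<le> 1"
proof -
  obtain F p where F: "orthonormal F" "\<forall>g\<in>F. 0 \<le> p g" "\<rho> = mixture F p id" "(\<Sum>g\<in>F. p g) = 1"
    using density_spectral_decomposition[OF assms] by metis
  have "norm (\<rho> $ i $ j) \<le> (\<Sum>g\<in>F. norm (of_real (p g) * (g $ i * cnj (g $ j))))"
    unfolding F(3) mixture_nth by (simp add: norm_sum)
  also have "\<dots> \<le> (\<Sum>g\<in>F. p g)"
  proof (rule sum_mono)
    fix g assume g: "g \<in> F"
    have "norm (g $ i) \<le> 1" "norm (g $ j) \<le> 1"
      using Finite_Cartesian_Product.norm_nth_le[of g] orthonormal_norm[OF F(1) g] by metis+
    then have "norm (g $ i) * norm (g $ j) \<le> 1" by (simp add: mult_le_one)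
    then show "norm (of_real (p g) * (g $ i * cnj (g $ j))) \<le> p g"
      using F(2) g by (simp add: norm_mult mult_left_le)
  qed
  finally show ?thesis using F(4) by simp
qed

lemma density_norm_bound:
  fixes \<rho> :: "complex^'n^'n"
  assumes "density \<rho>"
  shows "norm \<rho> \<le> real (CARD('n) * CARD('n))"
proof -
  have "norm \<rho> \<le> (\<Sum>i\<in>UNIV. \<Sum>j\<in>UNIV. norm (\<rho> $ i $ j))"
    by (rule order.trans[OF norm_vec_le_sum sum_mono[OF norm_vec_le_sum]])
  also have "\<dots> \<le> (\<Sum>i\<in>(UNIV::'n set). \<Sum>j\<in>(UNIV::'n set). 1)"
    by (intro sum_mono density_entry_bound[OF assms])
  finally show ?thesis by simp
qed

section \<open>Tensor products and the channel\<close>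

lemma sum_prod_UNIV:
  "(\<Sum>p\<in>(UNIV::('a::finite \<times> 'b::finite) set). f p) = (\<Sum>i\<in>UNIV. \<Sum>k\<in>UNIV. f (i, k))"
  by (simp add: sum.cartesian_product flip: UNIV_Times_UNIV)

lemma sum_sum_if_eq:
  fixes f :: "'a::finite \<Rightarrow> 'b::finite \<Rightarrow> 'c::comm_monoid_add"
  shows "(\<Sum>j\<in>UNIV. \<Sum>l\<in>UNIV. if i = j then f j l else 0) = (\<Sum>l\<in>UNIV. f i l)"
proof -
  have "(\<Sum>j\<in>UNIV. \<Sum>l\<in>UNIV. if i = j then f j l else 0)
      = (\<Sum>j\<in>UNIV. if i = j then (\<Sum>l\<in>UNIV. f j l) else 0)"
    by (intro sum.cong) auto
  then show ?thesis by simp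
qed

definition slice_fst :: "'a \<Rightarrow> complex^('a::finite \<times> 'b::finite) \<Rightarrow> complex^'b" where
  "slice_fst i x = (\<chi> k. x $ (i, k))"

definition slice_snd :: "'b \<Rightarrow> complex^('a::finite \<times> 'b::finite) \<Rightarrow> complex^'a" where
  "slice_snd k x = (\<chi> i. x $ (i, k))"

lemma cinner_slice_fst: "cinner x y = (\<Sum>i\<in>UNIV. cinner (slice_fst i x) (slice_fst i y))"
  by (simp add: cinner_def slice_fst_def sum_prod_UNIV)

lemma cinner_slice_snd: "cinner x y = (\<Sum>k\<in>UNIV. cinner (slice_snd k x) (slice_snd k y))"
proof -
  have "cinner x y = (\<Sum>i\<in>UNIV. \<Sum>k\<in>UNIV. cnj (x $ (i,k)) * y $ (i,k))"
    by (simp add: cinner_def sum_prod_UNIV)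
  also have "\<dots> = (\<Sum>k\<in>UNIV. \<Sum>i\<in>UNIV. cnj (x $ (i,k)) * y $ (i,k))"
    by (rule sum.swap)
  finally show ?thesis by (simp add: cinner_def slice_snd_def)
qed

lemma norm_square_slice_fst: "(norm x)^2 = (\<Sum>i\<in>UNIV. (norm (slice_fst i x))^2)"
  using arg_cong[OF cinner_slice_fst[of x x], of Re] by (simp add: cinner_self)

lemma norm_square_slice_snd: "(norm x)^2 = (\<Sum>k\<in>UNIV. (norm (slice_snd k x))^2)"
  using arg_cong[OF cinner_slice_snd[of x x], of Re] by (simp add: cinner_self)

lemma slice_snd_scale: "slice_snd k (c *s x) = c *s slice_snd k x"
  by (simp add: slice_snd_def vec_eq_iff)

lemma slice_snd_vkron: "slice_snd k (vkron v w) = w $ k *s v"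
  by (simp add: slice_snd_def vkron_def vec_eq_iff mult.commute)

lemma vkron_if_slice_fst:
  assumes "\<forall>i. slice_fst i x = c i *s w"
  shows "x = vkron (\<chi> i. c i) w"
  using assms by (simp add: vec_eq_iff slice_fst_def vkron_def)

lemma vkron_add_left: "vkron (a + b) w = vkron a w + vkron b w"
  by (simp add: vkron_def vec_eq_iff algebra_simps)

lemma vkron_diff_left: "vkron (a - b) w = vkron a w - vkron b w"
  by (simp add: vkron_def vec_eq_iff algebra_simps)

lemma vkron_scale_left: "vkron (c *s a) w = c *s vkron a w"
  by (simp add: vkron_def vec_eq_iff algebra_simps)

lemma vkron_zero_left [simp]: "vkron 0 w = 0"
  by (simp add: vkron_def vec_eq_iff)

lemma vkron_sum_left: "vkron (\<Sum>j\<in>J. f j) w = (\<Sum>j\<in>J. vkron (f j) w)"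
  by (induction J rule: infinite_finite_induct) (auto simp: vkron_add_left)

lemma cinner_vkron: "cinner (vkron a b) (vkron c d) = cinner a c * cinner b d"
  by (simp add: cinner_def vkron_def sum_prod_UNIV sum_product mult_ac)

lemma vkron_eq_0_iff: "w \<noteq> 0 \<Longrightarrow> vkron v w = 0 \<longleftrightarrow> v = 0"
  by (metis cinner_self_eq_0 cinner_vkron mult_eq_0_iff vkron_zero_left)

lemma kron_outer: "kron (outer v v) (outer w w) = outer (vkron v w) (vkron v w)"
  by (simp add: kron_def outer_def vkron_def vec_eq_iff mult_ac)

lemma kron_mat1_vkron: "kron A (mat 1) *v vkron v w = vkron (A *v v) w"
  by (simp add: vec_eq_iff matrix_vector_mult_def kron_def vkron_def sum_prod_UNIV mat_def
      if_distrib if_distribR sum_distrib_left mult_ac cong: if_cong)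

lemma mat1_kron_vkron: "kron (mat 1) B *v vkron v w = vkron v (B *v w)"
  by (simp add: vec_eq_iff matrix_vector_mult_def kron_def vkron_def sum_prod_UNIV mat_def
      if_distrib if_distribR sum_sum_if_eq sum_distrib_left mult_ac cong: if_cong)

lemma cinner_kron_mat1:
  "cinner x (kron A (mat 1) *v x) = (\<Sum>k\<in>UNIV. cinner (slice_snd k x) (A *v slice_snd k x))"
proof -
  have "cinner x (kron A (mat 1) *v x)
      = (\<Sum>i\<in>UNIV. \<Sum>k\<in>UNIV. cnj (x $ (i,k)) * (\<Sum>j\<in>UNIV. A $ i $ j * x $ (j, k)))"
    by (simp add: cinner_def matrix_vector_mult_def kron_def sum_prod_UNIV mat_def
        if_distrib if_distribR cong: if_cong)
  also have "\<dots> = (\<Sum>k\<in>UNIV. \<Sum>i\<in>UNIV. cnj (x $ (i,k)) * (\<Sum>j\<in>UNIV. A $ i $ j * x $ (j, k)))"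
    by (rule sum.swap)
  finally show ?thesis
    by (simp add: cinner_def matrix_vector_mult_def slice_snd_def)
qed

lemma cinner_mat1_kron:
  "cinner x (kron (mat 1) B *v x) = (\<Sum>i\<in>UNIV. cinner (slice_fst i x) (B *v slice_fst i x))"
proof -
  have "cinner x (kron (mat 1) B *v x)
      = (\<Sum>i\<in>UNIV. \<Sum>k\<in>UNIV. cnj (x $ (i,k)) * (\<Sum>l\<in>UNIV. B $ k $ l * x $ (i, l)))"
    by (simp add: cinner_def matrix_vector_mult_def kron_def sum_prod_UNIV mat_def
        if_distrib if_distribR sum_sum_if_eq cong: if_cong)
  then show ?thesis
    by (simp add: cinner_def matrix_vector_mult_def slice_fst_def)
qed

lemma ptrace_B_outer: "ptrace_B (outer x x) = mixture UNIV (\<lambda>_. 1) (\<lambda>k. slice_snd k x)"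
  by (simp add: vec_eq_iff ptrace_B_def outer_def mixture_nth slice_snd_def)

lemma ptrace_B_add: "ptrace_B (A + B) = ptrace_B A + ptrace_B B"
  by (simp add: ptrace_B_def vec_eq_iff sum.distrib)

lemma ptrace_B_scaleR: "ptrace_B (c *\<^sub>R A) = c *\<^sub>R ptrace_B A"
  by (simp add: ptrace_B_def vec_eq_iff scaleR_sum_right)

lemma matrix_add_rdistrib: "(B + C) ** A = B ** A + C ** A"
  by (vector matrix_matrix_mult_def sum.distrib[symmetric] field_simps)

lemma matrix_mult_uminus_left: "(- A) ** B = - (A ** B :: 'a::ring_1^'n^'m)"
  by (simp add: matrix_matrix_mult_def vec_eq_iff sum_negf)

lemma matrix_mult_uminus_right: "A ** (- B) = - (A ** B :: 'a::ring_1^'n^'m)"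
  by (simp add: matrix_matrix_mult_def vec_eq_iff sum_negf)

lemma matrix_vector_mult_uminus_left: "(- A) *v x = - (A *v x :: 'a::ring_1^'m)"
  by (simp add: matrix_vector_mult_def vec_eq_iff sum_negf)

lemma conj_outer: "A ** outer y y ** ctrans A = outer (A *v y) (A *v y)"
  by (simp add: matrix_eq outer_mult flip: matrix_vector_mul_assoc)
     (simp add: cinner_adjoint vec.scale)

lemma kron_add_left: "kron (A + B) C = kron A C + kron B C"
  by (simp add: kron_def vec_eq_iff algebra_simps)

lemma kron_scaleR_left: "kron (c *\<^sub>R A) C = c *\<^sub>R kron A C"
  by (simp add: kron_def vec_eq_iff matrix_scaleR_nth mult_ac)

definition channel ::
    "complex^('a::finite \<times> 'b::finite)^('a \<times> 'b) \<Rightarrow> complex^'b \<Rightarrow> complex^'a^'a \<Rightarrow> complex^'a^'a"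
  where
  "channel U \<phi> \<rho> = ptrace_B (U ** kron \<rho> (outer \<phi> \<phi>) ** ctrans U)"

lemma channel_add: "channel U \<phi> (A + B) = channel U \<phi> A + channel U \<phi> B"
  by (simp add: channel_def kron_add_left matrix_add_ldistrib matrix_add_rdistrib ptrace_B_add)

lemma channel_scaleR: "channel U \<phi> (c *\<^sub>R A) = c *\<^sub>R channel U \<phi> A"
  by (simp add: channel_def kron_scaleR_left matrix_scalar_ac ptrace_B_scaleR
      flip: scalar_matrix_assoc)

lemma bounded_linear_channel: "bounded_linear (channel U \<phi>)"
  unfolding linear_conv_bounded_linear[symmetric]
  by (rule linearI) (simp_all add: channel_add channel_scaleR)

lemma channel_outer:
  "channel U \<phi> (outer v v) = mixture UNIV (\<lambda>_. 1) (\<lambda>k. slice_snd k (U *v vkron v \<phi>))"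
  by (simp add: channel_def kron_outer conj_outer ptrace_B_outer)

lemma channel_mixture:
  assumes "finite J"
  shows "channel U \<phi> (mixture J w v)
    = mixture (J \<times> UNIV) (\<lambda>p. w (fst p)) (\<lambda>p. slice_snd (snd p) (U *v vkron (v (fst p)) \<phi>))"
proof -
  define y where "y j = U *v vkron (v j) \<phi>" for j
  have "channel U \<phi> (mixture J w v)
      = (\<Sum>j\<in>J. w j *\<^sub>R channel U \<phi> (outer (v j) (v j)))"
    unfolding mixture_def
    by (simp add: linear_sum[OF bounded_linear.linear[OF bounded_linear_channel]] channel_scaleR)
  also have "\<dots> = (\<Sum>j\<in>J. \<Sum>k\<in>UNIV. w j *\<^sub>R outer (slice_snd k (y j)) (slice_snd k (y j)))"
    by (simp add: channel_outer mixture_def scaleR_sum_right y_def)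
  finally show ?thesis
    unfolding mixture_def using assms by (simp add: sum.cartesian_product split_def y_def)
qed

definition expect :: "complex^'n^'n \<Rightarrow> complex^'n^'n \<Rightarrow> real" where
  "expect M \<rho> = Re (trace (M ** \<rho>))"

lemma bounded_linear_expect: "bounded_linear (expect M)"
  unfolding linear_conv_bounded_linear[symmetric]
  by (rule linearI)
     (simp_all add: expect_def matrix_add_ldistrib trace_add matrix_scalar_ac trace_scaleR
        flip: scalar_matrix_assoc)

lemma expect_mixture: "expect M (mixture J w v) = (\<Sum>j\<in>J. w j * Re (cinner (v j) (M *v v j)))"
proof -
  note lin = bounded_linear.linear[OF bounded_linear_expect]
  have "expect M (mixture J w v) = (\<Sum>j\<in>J. w j * expect M (outer (v j) (v j)))"
    unfolding mixture_def by (simp add: linear_sum[OF lin] linear_scale[OF lin])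
  then show ?thesis by (simp add: expect_def trace_mult_outer)
qed

definition in_support :: "complex^'n^'n \<Rightarrow> complex^'n \<Rightarrow> bool" where
  "in_support \<rho> x \<longleftrightarrow> (\<forall>y. \<rho> *v y = 0 \<longrightarrow> cinner y x = 0)"

lemma in_support_eigenvector:
  assumes "hermitian \<rho>" "\<rho> *v g = of_real p *s g" "p > 0"
  shows "in_support \<rho> g"
  unfolding in_support_def
proof (intro allI impI)
  fix y assume "\<rho> *v y = 0"
  then have "of_real p * cinner y g = 0"
    using assms(2) hermitian_cinner_swap[OF assms(1), of y g] by (simp add: cinner_scale_right)
  then show "cinner y g = 0" using assms(3) by simp
qed

lemma in_support_expansion:
  assumes "finite F" "\<forall>g\<in>F. 0 \<le> p g" "\<forall>g\<in>F. \<rho> *v g = of_real (p g) *s g"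
    and "\<forall>x. x = (\<Sum>g\<in>F. cinner g x *s g)" "in_support \<rho> x"
  shows "x = (\<Sum>g\<in>{g\<in>F. p g > 0}. cinner g x *s g)"
proof -
  have "x = (\<Sum>g\<in>F. cinner g x *s g)" using assms(4) by blast
  also have "\<dots> = (\<Sum>g\<in>{g\<in>F. p g > 0}. cinner g x *s g)"
  proof (rule sum.mono_neutral_right[OF assms(1)])
    show "\<forall>g\<in>F - {g\<in>F. p g > 0}. cinner g x *s g = 0"
      using assms(2,3,5) by (force simp: in_support_def)
  qed auto
  finally show ?thesis .
qed

section \<open>Energy decrease\<close>

locale ground_state_coupling =
  fixes MA :: "complex^'a::finite^'a" and MB :: "complex^'b::finite^'b"
    and U :: "complex^('a \<times> 'b)^('a \<times> 'b)" and \<phi> :: "complex^'b" and lam :: complex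
  assumes hermitian_MB: "hermitian MB" and unitary_U: "unitary U"
    and commute: "(kron MA (mat 1) + kron (mat 1) MB) ** U = U ** (kron MA (mat 1) + kron (mat 1) MB)"
    and norm_\<phi>: "norm \<phi> = 1" and eigen_\<phi>: "MB *v \<phi> = lam *s \<phi>"
    and lam_min: "\<forall>\<mu>. is_eigenvalue MB \<mu> \<longrightarrow> Re lam \<le> Re \<mu>"
    and lam_simple: "\<forall>v. MB *v v = lam *s v \<longrightarrow> (\<exists>c. v = c *s \<phi>)"
begin

abbreviation \<tau> where "\<tau> \<equiv> channel U \<phi>"
abbreviation E where "E \<equiv> expect MA"

lemma cinner_\<phi>: "cinner \<phi> \<phi> = 1"
  using norm_\<phi> by (simp add: cinner_self)

lemma \<phi>_nonzero: "\<phi> \<noteq> 0"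
  using norm_\<phi> by auto

lemma lam_real: "lam = of_real (Re lam)"
  by (rule hermitian_eigenvalue_real[OF hermitian_MB eigen_\<phi> \<phi>_nonzero])

lemma norm_U_vkron: "norm (U *v vkron v \<phi>) = norm v"
proof -
  have "cinner (U *v vkron v \<phi>) (U *v vkron v \<phi>) = cinner v v"
    by (simp add: unitary_cinner[OF unitary_U] cinner_vkron cinner_\<phi>)
  then have "(norm (U *v vkron v \<phi>))^2 = (norm v)^2" by (metis cinner_self of_real_eq_iff)
  then show ?thesis using power2_eq_iff_nonneg[of "norm (U *v vkron v \<phi>)" "norm v"] by simp
qed

lemma environment_energy_ge: "Re lam * (norm x)^2 \<le> Re (cinner x (kron (mat 1) MB *v x))"
  unfolding cinner_mat1_kron norm_square_slice_fst Re_sum sum_distrib_left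
  by (rule sum_mono) (rule hermitian_cinner_ge_eigenvalue_bound[OF hermitian_MB lam_min])

lemma environment_energy_eq_imp_product:
  assumes "Re (cinner x (kron (mat 1) MB *v x)) = Re lam * (norm x)^2"
  shows "\<exists>\<nu>. x = vkron \<nu> \<phi>"
proof -
  define s where "s i = slice_fst i x" for i
  have ge: "\<forall>i\<in>UNIV. 0 \<le> Re (cinner (s i) (MB *v s i)) - Re lam * (norm (s i))^2"
    using hermitian_cinner_ge_eigenvalue_bound[OF hermitian_MB lam_min] by simp
  have "(\<Sum>i\<in>UNIV. Re (cinner (s i) (MB *v s i)) - Re lam * (norm (s i))^2) = 0"
    using assms unfolding cinner_mat1_kron norm_square_slice_fst
    by (simp add: s_def Re_sum sum_subtractf sum_distrib_left)
  then have "\<forall>i\<in>UNIV. Re (cinner (s i) (MB *v s i)) - Re lam * (norm (s i))^2 = 0"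
    by (subst sum_nonneg_eq_0_iff[symmetric]) (use ge in auto)
  then have "Re (cinner (s i) (MB *v s i)) = Re lam * (norm (s i))^2" for i by simp
  then have "MB *v s i = of_real (Re lam) *s s i" for i
    by (rule hermitian_cinner_eq_eigenvalue_bound[OF hermitian_MB lam_min])
  then have "MB *v s i = lam *s s i" for i by (simp only: lam_real[symmetric])
  then have "\<forall>i. \<exists>c. s i = c *s \<phi>" using lam_simple by blast
  then obtain c where "\<forall>i. slice_fst i x = c i *s \<phi>" unfolding s_def by metis
  then show ?thesis by (blast intro: vkron_if_slice_fst)
qed

lemma energy_conservation:
  fixes v :: "complex^'a"
  defines "x \<equiv> U *v vkron v \<phi>"
  shows "cinner x (kron MA (mat 1) *v x) + cinner x (kron (mat 1) MB *v x)
    = cinner v (MA *v v) + lam * cinner v v"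
proof -
  define M where "M = kron MA (mat 1) + kron (mat 1) MB"
  have "M *v x = U *v (M *v vkron v \<phi>)"
    unfolding x_def M_def by (simp add: matrix_vector_mul_assoc commute)
  then have "cinner x (M *v x) = cinner (vkron v \<phi>) (M *v vkron v \<phi>)"
    by (simp add: x_def unitary_cinner[OF unitary_U])
  also have "\<dots> = cinner v (MA *v v) + lam * cinner v v"
    by (simp add: M_def matrix_vector_mult_add_rdistrib kron_mat1_vkron mat1_kron_vkron eigen_\<phi>
        cinner_add_right cinner_vkron cinner_scale_right cinner_\<phi>)
  finally show ?thesis by (simp add: M_def matrix_vector_mult_add_rdistrib cinner_add_right)
qed

lemma system_energy_decrease:
  fixes v :: "complex^'a"
  defines "x \<equiv> U *v vkron v \<phi>"
  shows system_energy_le: "Re (cinner x (kron MA (mat 1) *v x)) \<le> Re (cinner v (MA *v v))"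
    and system_energy_eq_imp_product:
      "Re (cinner x (kron MA (mat 1) *v x)) = Re (cinner v (MA *v v)) \<Longrightarrow> \<exists>\<nu>. x = vkron \<nu> \<phi>"
proof -
  have total: "Re (cinner x (kron MA (mat 1) *v x)) + Re (cinner x (kron (mat 1) MB *v x))
      = Re (cinner v (MA *v v)) + Re lam * (norm x)^2"
    using arg_cong[OF energy_conservation[of v], of Re] lam_real
    by (simp add: x_def norm_U_vkron cinner_self)
  then show "Re (cinner x (kron MA (mat 1) *v x)) \<le> Re (cinner v (MA *v v))"
    using environment_energy_ge[of x] by linarith
  assume "Re (cinner x (kron MA (mat 1) *v x)) = Re (cinner v (MA *v v))"
  with total show "\<exists>\<nu>. x = vkron \<nu> \<phi>"
    by (intro environment_energy_eq_imp_product) linarith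
qed

lemma expect_channel_mixture:
  assumes "finite J"
  shows "E (\<tau> (mixture J w v))
    = (\<Sum>j\<in>J. w j * Re (cinner (U *v vkron (v j) \<phi>) (kron MA (mat 1) *v (U *v vkron (v j) \<phi>))))"
proof -
  define y where "y j k = slice_snd k (U *v vkron (v j) \<phi>)" for j k
  have "E (\<tau> (mixture J w v))
      = (\<Sum>p\<in>J \<times> UNIV. w (fst p) * Re (cinner (y (fst p) (snd p)) (MA *v y (fst p) (snd p))))"
    by (simp add: channel_mixture[OF assms] expect_mixture y_def)
  also have "\<dots> = (\<Sum>j\<in>J. \<Sum>k\<in>UNIV. w j * Re (cinner (y j k) (MA *v y j k)))"
    using assms by (simp add: sum.cartesian_product split_def)
  finally show ?thesis by (simp add: cinner_kron_mat1 Re_sum sum_distrib_left y_def)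
qed

lemma expect_channel_mixture_decrease:
  assumes "finite J" "\<forall>j\<in>J. 0 \<le> w j"
  shows expect_channel_mixture_le: "E (\<tau> (mixture J w v)) \<le> E (mixture J w v)"
    and expect_channel_mixture_eq_imp_product:
      "E (\<tau> (mixture J w v)) = E (mixture J w v) \<Longrightarrow> j \<in> J \<Longrightarrow> w j > 0
        \<Longrightarrow> \<exists>\<nu>. U *v vkron (v j) \<phi> = vkron \<nu> \<phi>"
proof -
  define a where "a j = Re (cinner (U *v vkron (v j) \<phi>) (kron MA (mat 1) *v (U *v vkron (v j) \<phi>)))" for j
  define b where "b j = Re (cinner (v j) (MA *v v j))" for j
  have E_eq: "E (\<tau> (mixture J w v)) = (\<Sum>j\<in>J. w j * a j)" "E (mixture J w v) = (\<Sum>j\<in>J. w j * b j)"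
    by (simp_all add: expect_channel_mixture[OF assms(1)] expect_mixture a_def b_def)
  have gap: "\<forall>j\<in>J. 0 \<le> w j * b j - w j * a j"
    using assms(2) system_energy_le by (simp add: a_def b_def flip: right_diff_distrib)
  then show "E (\<tau> (mixture J w v)) \<le> E (mixture J w v)"
    unfolding E_eq by (simp add: sum_mono)
  assume eq: "E (\<tau> (mixture J w v)) = E (mixture J w v)" and j: "j \<in> J" "w j > 0"
  have "(\<Sum>i\<in>J. w i * b i - w i * a i) = E (mixture J w v) - E (\<tau> (mixture J w v))"
    unfolding E_eq by (rule sum_subtractf)
  with eq have "(\<Sum>i\<in>J. w i * b i - w i * a i) = 0" by linarith
  then have "w j * b j - w j * a j = 0"
    using sum_nonneg_eq_0_iff[OF assms(1), of "\<lambda>i. w i * b i - w i * a i"] gap j(1) by simp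
  with j(2) have "a j = b j" by simp
  then show "\<exists>\<nu>. U *v vkron (v j) \<phi> = vkron \<nu> \<phi>"
    unfolding a_def b_def by (rule system_energy_eq_imp_product)
qed

lemma density_channel:
  assumes "density \<rho>"
  shows "density (\<tau> \<rho>)"
proof -
  obtain F p where F: "finite F" "orthonormal F" "\<forall>g\<in>F. 0 \<le> p g" "\<rho> = mixture F p id"
      "(\<Sum>g\<in>F. p g) = 1"
    using density_spectral_decomposition[OF assms] by metis
  have "(\<Sum>q\<in>F \<times> UNIV. p (fst q) * (norm (slice_snd (snd q) (U *v vkron (id (fst q)) \<phi>)))^2)
      = (\<Sum>g\<in>F. \<Sum>k\<in>UNIV. p g * (norm (slice_snd k (U *v vkron g \<phi>)))^2)"
    using F(1) by (simp add: sum.cartesian_product split_def)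
  also have "\<dots> = (\<Sum>g\<in>F. p g * (norm (U *v vkron g \<phi>))^2)"
    by (simp add: norm_square_slice_snd sum_distrib_left)
  also have "\<dots> = 1" using F(5) orthonormal_norm[OF F(2)] by (simp add: norm_U_vkron)
  finally show ?thesis
    unfolding F(4) channel_mixture[OF F(1)] by (rule density_mixture[rotated]) (use F(3) in auto)
qed

lemma density_channel_iterate: "density \<rho> \<Longrightarrow> density ((\<tau> ^^ n) \<rho>)"
  by (induction n) (auto intro: density_channel)

lemma expect_channel_le:
  assumes "density \<rho>"
  shows "E (\<tau> \<rho>) \<le> E \<rho>"
proof -
  obtain F p where "finite F" "\<forall>g\<in>F. 0 \<le> p g" "\<rho> = mixture F p id"
    using density_spectral_decomposition[OF assms] by metis
  then show ?thesis using expect_channel_mixture_le by blast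
qed

lemma energy_conserving_step:
  assumes "density \<sigma>" "E (\<tau> \<sigma>) = E \<sigma>" "in_support \<sigma> x"
  shows "\<exists>\<nu>. U *v vkron x \<phi> = vkron \<nu> \<phi> \<and> in_support (\<tau> \<sigma>) \<nu>"
proof -
  obtain F p where F: "finite F" "orthonormal F" "\<forall>g\<in>F. 0 \<le> p g" "\<sigma> = mixture F p id"
      "(\<Sum>g\<in>F. p g) = 1" "\<forall>g\<in>F. \<sigma> *v g = of_real (p g) *s g"
      "\<forall>x. x = (\<Sum>g\<in>F. cinner g x *s g)"
    by (rule density_spectral_decomposition[OF assms(1)])
  define G where "G = {g\<in>F. p g > 0}"
  have E_eq: "E (\<tau> (mixture F p id)) = E (mixture F p id)" using assms(2) F(4) by simp
  have "\<exists>\<nu>. U *v vkron g \<phi> = vkron \<nu> \<phi>" if "g \<in> G" for g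
    using expect_channel_mixture_eq_imp_product[OF F(1,3) E_eq, where j=g] that
    by (simp add: G_def)
  then have "\<forall>g\<in>G. \<exists>\<nu>. U *v vkron g \<phi> = vkron \<nu> \<phi>" by blast
  from bchoice[OF this] obtain \<nu> where \<nu>: "\<forall>g\<in>G. U *v vkron g \<phi> = vkron (\<nu> g) \<phi>"
    by blast
  have x: "x = (\<Sum>g\<in>G. cinner g x *s g)"
    unfolding G_def by (rule in_support_expansion[OF F(1,3,6,7) assms(3)])
  define y where "y = (\<Sum>g\<in>G. cinner g x *s \<nu> g)"
  have "U *v vkron x \<phi> = (\<Sum>g\<in>G. cinner g x *s (U *v vkron g \<phi>))"
    by (subst x) (simp add: vkron_sum_left vkron_scale_left vec.sum vec.scale)
  also have "\<dots> = vkron y \<phi>"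
    using \<nu> by (simp add: y_def vkron_sum_left vkron_scale_left)
  finally have Uy: "U *v vkron x \<phi> = vkron y \<phi>" .
  obtain k where k: "\<phi> $ k \<noteq> 0" using \<phi>_nonzero by (metis vec_eq_iff zero_index)
  have "in_support (\<tau> \<sigma>) y"
    unfolding in_support_def
  proof (intro allI impI)
    fix z assume z: "\<tau> \<sigma> *v z = 0"
    have "cinner (\<nu> g) z = 0" if "g \<in> G" for g
    proof -
      have "\<tau> \<sigma> = mixture (F \<times> UNIV) (\<lambda>q. p (fst q)) (\<lambda>q. slice_snd (snd q) (U *v vkron (fst q) \<phi>))"
        by (simp add: F(4) channel_mixture[OF F(1)])
      then have "cinner (slice_snd k (U *v vkron g \<phi>)) z = 0"
        using mixture_kernel[of "F \<times> UNIV" "\<lambda>q. p (fst q)"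
            "\<lambda>q. slice_snd (snd q) (U *v vkron (fst q) \<phi>)" z "(g, k)"] z F(1,3) that
        by (auto simp: G_def)
      then show ?thesis
        using \<nu> that k by (simp add: slice_snd_vkron cinner_scale_left)
    qed
    then show "cinner z y = 0"
      by (simp add: y_def cinner_sum_right cinner_scale_right cinner_commute[of z])
  qed
  with Uy show ?thesis by blast
qed

definition product_space :: "(complex^('a \<times> 'b)) set" where
  "product_space = range (\<lambda>\<nu>. vkron \<nu> \<phi>)"

text \<open>The largest \<open>U\<close>-invariant subspace of the product space \<open>\<H>\<^sub>A \<otimes> \<phi>\<close>.\<close>

definition stable_space :: "(complex^('a \<times> 'b)) set" where
  "stable_space = {z. \<forall>k. ((*v) U ^^ k) z \<in> product_space}"

lemma support_in_stable_space:
  assumes "density \<sigma>" "\<forall>m. E (\<tau> ((\<tau> ^^ m) \<sigma>)) = E ((\<tau> ^^ m) \<sigma>)" "in_support \<sigma> x"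
  shows "vkron x \<phi> \<in> stable_space"
proof -
  have "\<forall>m x. in_support ((\<tau> ^^ m) \<sigma>) x \<longrightarrow> ((*v) U ^^ k) (vkron x \<phi>) \<in> product_space" for k
  proof (induction k)
    case 0
    then show ?case by (simp add: product_space_def)
  next
    case (Suc k)
    show ?case
    proof (intro allI impI)
      fix m x assume "in_support ((\<tau> ^^ m) \<sigma>) x"
      then obtain \<nu> where \<nu>: "U *v vkron x \<phi> = vkron \<nu> \<phi>" "in_support ((\<tau> ^^ Suc m) \<sigma>) \<nu>"
        using energy_conserving_step[OF density_channel_iterate[OF assms(1)] assms(2)[rule_format]]
        by auto
      then have "((*v) U ^^ k) (vkron \<nu> \<phi>) \<in> product_space" using Suc.IH by blast
      then show "((*v) U ^^ Suc k) (vkron x \<phi>) \<in> product_space"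
        using \<nu>(1) by (simp add: funpow_Suc_right del: funpow.simps)
    qed
  qed
  then have "((*v) U ^^ k) (vkron x \<phi>) \<in> product_space" for k
    using assms(3) by (metis funpow_0)
  then show ?thesis by (simp add: stable_space_def)
qed

end

section \<open>Limit points and fixed states\<close>

definition pure_state :: "complex^'n \<Rightarrow> complex^'n^'n" where
  "pure_state \<nu> = (1 / (norm \<nu>)^2) *\<^sub>R outer \<nu> \<nu>"

lemma density_pure_state: "\<nu> \<noteq> 0 \<Longrightarrow> density (pure_state \<nu>)"
  using density_mixture[of "{\<nu>}" "\<lambda>_. 1 / (norm \<nu>)^2" id]
  by (simp add: pure_state_def mixture_def)

lemma pure_state_mult: "pure_state \<nu> *v x = (of_real (1 / (norm \<nu>)^2) * cinner \<nu> x) *s \<nu>"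
  using mixture_mult[of "{\<nu>}" "\<lambda>_. 1 / (norm \<nu>)^2" id x]
  by (simp add: pure_state_def mixture_def)

text \<open>LaSalle's invariance principle in discrete time: along a limit point of an orbit, a
  continuous Lyapunov function is constant.\<close>

lemma lyapunov_constant_on_limit_point:
  fixes f :: "'a::t2_space \<Rightarrow> 'a" and V :: "'a \<Rightarrow> real"
  assumes cont: "\<And>z. isCont f z" "\<And>z. isCont V z"
    and decrease: "\<And>n. V ((f ^^ Suc n) x) \<le> V ((f ^^ n) x)"
    and lim: "strict_mono t" "(\<lambda>j. (f ^^ t j) x) \<longlonglongrightarrow> y"
  shows "V ((f ^^ m) y) = V y"
proof -
  define e where "e n = V ((f ^^ n) x)" for n
  have dec: "decseq e" unfolding decseq_Suc_iff e_def using decrease by blast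
  have "isCont (f ^^ k) z" for k z
  proof (induction k arbitrary: z)
    case 0
    show ?case by (simp add: id_def)
  next
    case (Suc k)
    show ?case using isCont_o2[OF Suc.IH cont(1)] by (simp add: o_def)
  qed
  then have e_lim: "(\<lambda>j. e (t j + k)) \<longlonglongrightarrow> V ((f ^^ k) y)" for k
    using isCont_tendsto_compose[OF cont(2) isCont_tendsto_compose[OF _ lim(2)]]
    by (simp add: e_def funpow_add add.commute)
  have "V y \<le> e n" for n
  proof (rule LIMSEQ_le_const2[OF e_lim[of 0, simplified]])
    show "\<exists>N. \<forall>j\<ge>N. e (t j) \<le> e n"
      using dec seq_suble[OF lim(1)] by (metis antimonoD le_trans)
  qed
  then obtain L where L: "e \<longlonglongrightarrow> L" using decseq_convergent[OF dec] by blast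
  have "(\<lambda>j. e (t j + k)) \<longlonglongrightarrow> L" for k
    using LIMSEQ_subseq_LIMSEQ[OF L, of "\<lambda>j. t j + k"] lim(1)
    by (simp add: strict_mono_def o_def)
  then have "V ((f ^^ k) y) = L" for k using e_lim LIMSEQ_unique by blast
  from this[of m] this[of 0] show ?thesis by simp
qed

lemma LIMSEQ_if_unique_limit_point:
  fixes X :: "nat \<Rightarrow> 'a::heine_borel"
  assumes "bounded (range X)" and unique: "\<And>t l. strict_mono t \<Longrightarrow> (X \<circ> t) \<longlonglongrightarrow> l \<Longrightarrow> l = L"
  shows "X \<longlonglongrightarrow> L"
proof (rule ccontr)
  assume "\<not> X \<longlonglongrightarrow> L"
  then obtain \<epsilon> where "\<epsilon> > 0" "\<forall>N. \<exists>n\<ge>N. \<epsilon> \<le> dist (X n) L"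
    unfolding lim_sequentially by (meson not_le)
  then have far: "infinite {n. \<epsilon> \<le> dist (X n) L}"
    by (simp add: infinite_nat_iff_unbounded_le)
  define r where "r = enumerate {n. \<epsilon> \<le> dist (X n) L}"
  have r: "strict_mono r" "\<forall>j. \<epsilon> \<le> dist (X (r j)) L"
    using strict_mono_enumerate[OF far] enumerate_in_set[OF far] by (auto simp: r_def)
  have "bounded (range (X \<circ> r))"
    using assms(1) by (rule bounded_subset) auto
  then obtain s l where s: "strict_mono s" "((X \<circ> r) \<circ> s) \<longlonglongrightarrow> l"
    using bounded_imp_convergent_subsequence by blast
  then have "l = L" using unique[of "r \<circ> s"] strict_mono_o[OF r(1) s(1)] by (simp add: o_assoc)
  with s(2) \<open>\<epsilon> > 0\<close> obtain j where "dist (X (r (s j))) L < \<epsilon>"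
    unfolding lim_sequentially by auto
  with r(2) show False by (meson not_le)
qed

context ground_state_coupling
begin

lemma subspace_stable_space: "vec.subspace stable_space"
proof -
  have "vec.subspace product_space"
    unfolding vec.subspace_def product_space_def
    by (auto simp: image_iff intro: exI[of _ 0] simp flip: vkron_add_left vkron_scale_left)
  moreover have "((*v) U ^^ k) (a + b) = ((*v) U ^^ k) a + ((*v) U ^^ k) b"
    and "((*v) U ^^ k) (c *s a) = c *s ((*v) U ^^ k) a"
    and "((*v) U ^^ k) 0 = 0" for k a b c
    by (induction k) (simp_all add: matrix_vector_right_distrib vec.scale)
  ultimately show ?thesis
    unfolding vec.subspace_def stable_space_def by auto
qed

lemma stable_space_invariant: "\<forall>y\<in>stable_space. U *v y \<in> stable_space"
  unfolding stable_space_def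
proof (intro ballI CollectI allI)
  fix y k assume "y \<in> {z. \<forall>k. ((*v) U ^^ k) z \<in> product_space}"
  then have "((*v) U ^^ Suc k) y \<in> product_space" by blast
  then show "((*v) U ^^ k) (U *v y) \<in> product_space" by (simp only: funpow_Suc_right comp_apply)
qed

lemma stable_space_subset: "stable_space \<subseteq> product_space"
  by (auto simp: stable_space_def dest: spec[of _ 0])

lemma eigenvector_in_stable_space:
  assumes "U *v vkron \<nu> \<phi> = \<mu> *s vkron \<nu> \<phi>"
  shows "vkron \<nu> \<phi> \<in> stable_space"
proof -
  have "((*v) U ^^ k) (vkron \<nu> \<phi>) = vkron (\<mu>^k *s \<nu>) \<phi>" for k
    by (induction k) (auto simp: assms vec.scale vector_smult_assoc mult.commute vkron_scale_left)
  then show ?thesis by (simp add: stable_space_def product_space_def)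
qed

lemma stable_space_has_product_eigenvector:
  assumes "vkron x \<phi> \<in> stable_space" "x \<noteq> 0"
  obtains \<nu> where "is_eigenvector U (vkron \<nu> \<phi>)"
proof -
  have "vkron x \<phi> \<noteq> 0" using assms(2) vkron_eq_0_iff[OF \<phi>_nonzero] by blast
  then obtain y \<mu> where y: "y \<in> stable_space" "y \<noteq> 0" "U *v y = \<mu> *s y"
    using invariant_subspace_has_eigenvector[OF subspace_stable_space stable_space_invariant assms(1)]
    by blast
  obtain \<nu> where "y = vkron \<nu> \<phi>"
    using stable_space_subset y(1) unfolding product_space_def by blast
  with y show ?thesis using that by (auto simp: is_eigenvector_def)
qed

text \<open>The adjoint of a unitary has the same eigenvectors, so orthogonal complements of its
  eigenvectors are invariant.\<close>

lemma stable_space_orthogonal_invariant: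
  assumes "U *v e = \<mu> *s e" "e \<noteq> 0"
  shows "\<forall>y\<in>stable_space \<inter> {z. cinner e z = 0}. U *v y \<in> stable_space \<inter> {z. cinner e z = 0}"
  using stable_space_invariant
  by (auto simp: cinner_adjoint_right unitary_adjoint_eigenvector[OF unitary_U assms] cinner_scale_left)

text \<open>If the product eigenvector is unique, the stable space is spanned by it: a nonzero vector
  of the stable space orthogonal to it would yield a second product eigenvector.\<close>

lemma stable_space_unique:
  assumes ev: "is_eigenvector U (vkron \<nu> \<phi>)"
    and unique: "\<forall>\<nu>'. is_eigenvector U (vkron \<nu>' \<phi>) \<longrightarrow> (\<exists>c. vkron \<nu>' \<phi> = c *s vkron \<nu> \<phi>)"
    and x: "vkron x \<phi> \<in> stable_space"
  shows "\<exists>c. x = c *s \<nu>"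
proof -
  define e where "e = vkron \<nu> \<phi>"
  obtain \<mu> where \<mu>: "U *v e = \<mu> *s e" and "e \<noteq> 0"
    using ev by (auto simp: is_eigenvector_def e_def)
  then have "\<nu> \<noteq> 0" by (auto simp: e_def)
  define x' where "x' = x - (cinner \<nu> x / cinner \<nu> \<nu>) *s \<nu>"
  define S where "S = stable_space \<inter> {z. cinner e z = 0}"
  have "vec.subspace S"
    using subspace_stable_space unfolding S_def vec.subspace_def
    by (auto simp: cinner_add_right cinner_scale_right)
  moreover have "\<forall>y\<in>S. U *v y \<in> S"
    unfolding S_def by (rule stable_space_orthogonal_invariant[OF \<mu> \<open>e \<noteq> 0\<close>])
  moreover have "vkron x' \<phi> \<in> S"
  proof -
    have "vkron x' \<phi> = vkron x \<phi> - (cinner \<nu> x / cinner \<nu> \<nu>) *s e"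
      by (simp add: x'_def e_def vkron_diff_left vkron_scale_left)
    moreover have "e \<in> stable_space"
      using eigenvector_in_stable_space \<mu> by (simp add: e_def)
    ultimately have "vkron x' \<phi> \<in> stable_space"
      using x subspace_stable_space by (simp add: vec.subspace_diff vec.subspace_scale)
    moreover have "cinner e (vkron x' \<phi>) = 0"
      using \<open>\<nu> \<noteq> 0\<close>
      by (simp add: e_def x'_def cinner_vkron cinner_\<phi> cinner_diff_right cinner_scale_right)
    ultimately show ?thesis by (simp add: S_def)
  qed
  moreover have "y = 0" if y: "y \<in> S" "U *v y = \<mu>' *s y" for y \<mu>'
  proof -
    obtain \<nu>' where \<nu>': "y = vkron \<nu>' \<phi>"
      using stable_space_subset y(1) unfolding S_def product_space_def by blast
    show "y = 0"
    proof (rule ccontr)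
      assume "y \<noteq> 0"
      then have "is_eigenvector U (vkron \<nu>' \<phi>)" using y(2) \<nu>' by (auto simp: is_eigenvector_def)
      then obtain c where "y = c *s e" using unique \<nu>' by (auto simp: e_def)
      moreover have "cinner e y = 0" using y(1) by (simp add: S_def)
      ultimately show False using \<open>y \<noteq> 0\<close> \<open>e \<noteq> 0\<close> by (simp add: cinner_scale_right)
    qed
  qed
  ultimately have "vkron x' \<phi> = 0" using invariant_subspace_has_eigenvector by blast
  then have "x' = 0" using vkron_eq_0_iff[OF \<phi>_nonzero] by blast
  then have "x = (cinner \<nu> x / cinner \<nu> \<nu>) *s \<nu>" by (simp add: x'_def)
  then show ?thesis by blast
qed

lemma energy_conserving_state_product_eigenvector:
  assumes "density \<sigma>" "\<forall>m. E (\<tau> ((\<tau> ^^ m) \<sigma>)) = E ((\<tau> ^^ m) \<sigma>)"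
  obtains \<nu> where "is_eigenvector U (vkron \<nu> \<phi>)"
proof -
  obtain F p where F: "finite F" "orthonormal F" "\<forall>g\<in>F. 0 \<le> p g" "\<sigma> = mixture F p id"
      "(\<Sum>g\<in>F. p g) = 1" "\<forall>g\<in>F. \<sigma> *v g = of_real (p g) *s g"
      "\<forall>x. x = (\<Sum>g\<in>F. cinner g x *s g)"
    by (rule density_spectral_decomposition[OF assms(1)])
  obtain g where g: "g \<in> F" "p g > 0"
    using F(3,5) sum_nonneg_eq_0_iff[OF F(1), of p] by (metis less_eq_real_def zero_neq_one)
  have "in_support \<sigma> g"
    using in_support_eigenvector[OF hermitian_mixture] F(4,6) g by metis
  then have "vkron g \<phi> \<in> stable_space" by (rule support_in_stable_space[OF assms])
  moreover have "g \<noteq> 0" by (rule orthonormal_nonzero[OF F(2) g(1)])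
  ultimately show ?thesis using stable_space_has_product_eigenvector that by blast
qed

lemma energy_conserving_state_eq_pure_state:
  assumes ev: "is_eigenvector U (vkron \<nu> \<phi>)"
    and unique: "\<forall>\<nu>'. is_eigenvector U (vkron \<nu>' \<phi>) \<longrightarrow> (\<exists>c. vkron \<nu>' \<phi> = c *s vkron \<nu> \<phi>)"
    and \<sigma>: "density \<sigma>" "\<forall>m. E (\<tau> ((\<tau> ^^ m) \<sigma>)) = E ((\<tau> ^^ m) \<sigma>)"
  shows "\<sigma> = pure_state \<nu>"
proof -
  have "\<nu> \<noteq> 0" using ev by (auto simp: is_eigenvector_def)
  obtain F p where F: "finite F" "orthonormal F" "\<forall>g\<in>F. 0 \<le> p g" "\<sigma> = mixture F p id"
      "(\<Sum>g\<in>F. p g) = 1" "\<forall>g\<in>F. \<sigma> *v g = of_real (p g) *s g"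
      "\<forall>x. x = (\<Sum>g\<in>F. cinner g x *s g)"
    by (rule density_spectral_decomposition[OF \<sigma>(1)])
  have "\<exists>c. g = c *s \<nu>" if "g \<in> F" "p g > 0" for g
  proof -
    have "in_support \<sigma> g"
      using in_support_eigenvector[OF hermitian_mixture] F(4,6) that by metis
    then have "vkron g \<phi> \<in> stable_space" by (rule support_in_stable_space[OF \<sigma>])
    then show ?thesis by (rule stable_space_unique[OF ev unique])
  qed
  then obtain c where c: "\<forall>g\<in>F. p g > 0 \<longrightarrow> g = c g *s \<nu>" by metis
  define \<alpha> where "\<alpha> = (\<Sum>g\<in>F. p g * (cmod (c g))^2)"
  have "p g *\<^sub>R outer g g = (p g * (cmod (c g))^2) *\<^sub>R outer \<nu> \<nu>" if "g \<in> F" for g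
  proof (cases "p g > 0")
    case True
    then show ?thesis using c that by (metis outer_scale scaleR_scaleR)
  next
    case False
    then have "p g = 0" using F(3) that by force
    then show ?thesis by simp
  qed
  then have \<sigma>_eq: "\<sigma> = \<alpha> *\<^sub>R outer \<nu> \<nu>"
    by (simp add: F(4) mixture_def \<alpha>_def scaleR_sum_left cong: sum.cong)
  have "trace \<sigma> = 1" using \<sigma>(1) by (simp add: density_def)
  then have "complex_of_real (\<alpha> * (norm \<nu>)^2) = 1"
    using trace_mult_outer[of "mat 1" \<nu>] by (simp add: \<sigma>_eq trace_scaleR cinner_self)
  then have "\<alpha> * (norm \<nu>)^2 = 1" by (simp only: of_real_eq_1_iff)
  then have "\<alpha> = 1 / (norm \<nu>)^2" using \<open>\<nu> \<noteq> 0\<close> by (simp add: field_simps)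
  then show ?thesis by (simp add: \<sigma>_eq pure_state_def)
qed

lemma channel_fixes_pure_eigenstate:
  assumes "is_eigenvector U (vkron \<nu> \<phi>)"
  shows "\<tau> (pure_state \<nu>) = pure_state \<nu>"
proof -
  obtain \<mu> where \<mu>: "U *v vkron \<nu> \<phi> = \<mu> *s vkron \<nu> \<phi>" and "vkron \<nu> \<phi> \<noteq> 0"
    using assms by (auto simp: is_eigenvector_def)
  then have "cmod \<mu> = 1" by (rule unitary_eigenvalue_norm[OF unitary_U])
  have "\<tau> (outer \<nu> \<nu>) = (\<Sum>k\<in>UNIV. outer ((\<mu> * \<phi> $ k) *s \<nu>) ((\<mu> * \<phi> $ k) *s \<nu>))"
    by (simp add: channel_outer mixture_def \<mu> slice_snd_scale slice_snd_vkron vector_smult_assoc)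
  also have "\<dots> = (\<Sum>k\<in>UNIV. (cmod (\<phi> $ k))^2) *\<^sub>R outer \<nu> \<nu>"
    by (simp add: outer_scale scaleR_sum_left norm_mult \<open>cmod \<mu> = 1\<close>)
  also have "\<dots> = outer \<nu> \<nu>" by (simp add: norm_\<phi> flip: norm_vec_square)
  finally show ?thesis by (simp add: pure_state_def channel_scaleR)
qed

lemma mixing_if_unique_product_eigenvector:
  assumes ev: "is_eigenvector U (vkron \<nu> \<phi>)"
    and unique: "\<forall>\<nu>'. is_eigenvector U (vkron \<nu>' \<phi>) \<longrightarrow> (\<exists>c. vkron \<nu>' \<phi> = c *s vkron \<nu> \<phi>)"
  shows "mixing \<tau>"
  unfolding mixing_def
proof (intro exI conjI allI impI)
  show "density (pure_state \<nu>)"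
    using ev by (auto intro: density_pure_state simp: is_eigenvector_def)
  fix \<rho> :: "complex^'a^'a" assume \<rho>: "density \<rho>"
  show "(\<lambda>n. (\<tau> ^^ n) \<rho>) \<longlonglongrightarrow> pure_state \<nu>"
  proof (rule LIMSEQ_if_unique_limit_point)
    show "bounded (range (\<lambda>n. (\<tau> ^^ n) \<rho>))"
      unfolding bounded_iff using density_norm_bound[OF density_channel_iterate[OF \<rho>]] by blast
    fix t \<sigma> assume t: "strict_mono t" "((\<lambda>n. (\<tau> ^^ n) \<rho>) \<circ> t) \<longlonglongrightarrow> \<sigma>"
    then have "density \<sigma>"
      by (intro density_limit[of "(\<lambda>n. (\<tau> ^^ n) \<rho>) \<circ> t"]) (simp_all add: density_channel_iterate[OF \<rho>])
    moreover have "E ((\<tau> ^^ m) \<sigma>) = E \<sigma>" for m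
      using t by (intro lyapunov_constant_on_limit_point[where f = \<tau> and x = \<rho> and t = t])
        (simp_all add: linear_continuous_at bounded_linear_channel bounded_linear_expect o_def
          expect_channel_le density_channel_iterate[OF \<rho>])
    then have "\<forall>m. E (\<tau> ((\<tau> ^^ m) \<sigma>)) = E ((\<tau> ^^ m) \<sigma>)"
      by (metis funpow.simps(2) comp_apply)
    ultimately show "\<sigma> = pure_state \<nu>"
      by (rule energy_conserving_state_eq_pure_state[OF ev unique])
  qed
qed

lemma unique_product_eigenvector_if_mixing:
  assumes "mixing \<tau>"
  shows "\<exists>\<nu>. is_eigenvector U (vkron \<nu> \<phi>) \<and>
    (\<forall>\<nu>'. is_eigenvector U (vkron \<nu>' \<phi>) \<longrightarrow> (\<exists>c. vkron \<nu>' \<phi> = c *s vkron \<nu> \<phi>))"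
proof -
  obtain \<rho>\<^sub>s where \<rho>\<^sub>s: "density \<rho>\<^sub>s" "\<forall>\<rho>. density \<rho> \<longrightarrow> (\<lambda>n. (\<tau> ^^ n) \<rho>) \<longlonglongrightarrow> \<rho>\<^sub>s"
    using assms by (auto simp: mixing_def)
  then have lim: "(\<lambda>n. (\<tau> ^^ n) \<rho>\<^sub>s) \<longlonglongrightarrow> \<rho>\<^sub>s" by blast
  then have "(\<lambda>n. \<tau> ((\<tau> ^^ n) \<rho>\<^sub>s)) \<longlonglongrightarrow> \<tau> \<rho>\<^sub>s"
    by (rule bounded_linear.tendsto[OF bounded_linear_channel])
  moreover have "(\<lambda>n. \<tau> ((\<tau> ^^ n) \<rho>\<^sub>s)) \<longlonglongrightarrow> \<rho>\<^sub>s" using LIMSEQ_Suc[OF lim] by simp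
  ultimately have fixed: "\<tau> \<rho>\<^sub>s = \<rho>\<^sub>s" by (rule LIMSEQ_unique)
  then have "(\<tau> ^^ m) \<rho>\<^sub>s = \<rho>\<^sub>s" for m by (induction m) auto
  then obtain \<nu> where \<nu>: "is_eigenvector U (vkron \<nu> \<phi>)"
    using energy_conserving_state_product_eigenvector[OF \<rho>\<^sub>s(1)] fixed by auto
  have pure_eq: "pure_state \<nu>' = \<rho>\<^sub>s" if "is_eigenvector U (vkron \<nu>' \<phi>)" for \<nu>'
  proof -
    have "density (pure_state \<nu>')"
      using that by (auto intro: density_pure_state simp: is_eigenvector_def)
    then have "(\<lambda>n. (\<tau> ^^ n) (pure_state \<nu>')) \<longlonglongrightarrow> \<rho>\<^sub>s" using \<rho>\<^sub>s(2) by blast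
    moreover have "(\<tau> ^^ n) (pure_state \<nu>') = pure_state \<nu>'" for n
      by (induction n) (simp_all add: channel_fixes_pure_eigenstate[OF that])
    ultimately show ?thesis by (simp add: LIMSEQ_const_iff)
  qed
  have "\<exists>c. vkron \<nu>' \<phi> = c *s vkron \<nu> \<phi>" if ev': "is_eigenvector U (vkron \<nu>' \<phi>)" for \<nu>'
  proof -
    have "\<nu>' \<noteq> 0" using ev' by (auto simp: is_eigenvector_def)
    then have "\<nu>' = pure_state \<nu>' *v \<nu>'" by (simp add: pure_state_mult cinner_self power2_eq_square)
    also have "\<dots> = pure_state \<nu> *v \<nu>'" using pure_eq[OF ev'] pure_eq[OF \<nu>] by simp
    also have "\<dots> = (of_real (1 / (norm \<nu>)^2) * cinner \<nu> \<nu>') *s \<nu>" by (rule pure_state_mult)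
    finally show ?thesis by (metis vkron_scale_left)
  qed
  with \<nu> show ?thesis by blast
qed

theorem mixing_iff_unique_product_eigenvector:
  "mixing \<tau> \<longleftrightarrow> (\<exists>\<nu>. is_eigenvector U (vkron \<nu> \<phi>) \<and>
    (\<forall>\<nu>'. is_eigenvector U (vkron \<nu>' \<phi>) \<longrightarrow> (\<exists>c. vkron \<nu>' \<phi> = c *s vkron \<nu> \<phi>)))"
  using unique_product_eigenvector_if_mixing mixing_if_unique_product_eigenvector by blast

end

text \<open>Reduces the case of a maximal eigenvalue to that of a minimal one.\<close>

lemma ground_state_coupling_negate:
  assumes "hermitian MB" "unitary U"
    and "(kron MA (mat 1) + kron (mat 1) MB) ** U = U ** (kron MA (mat 1) + kron (mat 1) MB)"
    and "norm \<phi> = 1" "MB *v \<phi> = lam *s \<phi>"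
    and "\<forall>\<mu>. is_eigenvalue MB \<mu> \<longrightarrow> Re \<mu> \<le> Re lam"
    and "\<forall>v. MB *v v = lam *s v \<longrightarrow> (\<exists>c. v = c *s \<phi>)"
  shows "ground_state_coupling (- MA) (- MB) U \<phi> (- lam)"
proof
  show "hermitian (- MB)" using assms(1) by (simp add: hermitian_def ctrans_def vec_eq_iff)
  have "kron (- MA) (mat 1) + kron (mat 1) (- MB) = - (kron MA (mat 1) + kron (mat 1) MB)"
    by (simp add: kron_def vec_eq_iff)
  then show "(kron (- MA) (mat 1) + kron (mat 1) (- MB)) ** U
      = U ** (kron (- MA) (mat 1) + kron (mat 1) (- MB))"
    using assms(3) by (simp only: matrix_mult_uminus_left matrix_mult_uminus_right)
  show "(- MB) *v \<phi> = (- lam) *s \<phi>"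
    using assms(5) by (simp add: matrix_vector_mult_uminus_left vector_smult_lneg)
  show "\<forall>\<mu>. is_eigenvalue (- MB) \<mu> \<longrightarrow> Re (- lam) \<le> Re \<mu>"
  proof (intro allI impI)
    fix \<mu> assume "is_eigenvalue (- MB) \<mu>"
    then obtain v where v: "v \<noteq> 0" "(- MB) *v v = \<mu> *s v" by (auto simp: is_eigenvalue_def)
    then have "MB *v v = (- \<mu>) *s v"
      by (metis matrix_vector_mult_uminus_left minus_minus vector_smult_lneg)
    with v(1) have "is_eigenvalue MB (- \<mu>)" by (auto simp: is_eigenvalue_def)
    then show "Re (- lam) \<le> Re \<mu>" using assms(6) by fastforce
  qed
  show "\<forall>v. (- MB) *v v = (- lam) *s v \<longrightarrow> (\<exists>c. v = c *s \<phi>)"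
    using assms(7) by (simp add: matrix_vector_mult_uminus_left vector_smult_lneg)
qed (use assms in auto)

theorem mainTheorem16:
  fixes MA :: "complex^'a::finite^'a" and MB :: "complex^'b::finite^'b"
    and U :: "complex^('a \<times> 'b)^('a \<times> 'b)"
    and \<phi> :: "complex^'b" and lam :: complex
  assumes "hermitian MA" and "hermitian MB"
    and "unitary U"
    and "(kron MA (mat 1) + kron (mat 1) MB) ** U = U ** (kron MA (mat 1) + kron (mat 1) MB)"
    and "norm \<phi> = 1" and "MB *v \<phi> = lam *s \<phi>"
    and "(\<forall>\<mu>. is_eigenvalue MB \<mu> \<longrightarrow> Re \<mu> \<le> Re lam) \<or> (\<forall>\<mu>. is_eigenvalue MB \<mu> \<longrightarrow> Re lam \<le> Re \<mu>)"
    and "\<forall>v. MB *v v = lam *s v \<longrightarrow> (\<exists>c. v = c *s \<phi>)"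
  shows "mixing (\<lambda>\<rho>. ptrace_B (U ** kron \<rho> (outer \<phi> \<phi>) ** ctrans U))
     \<longleftrightarrow> (\<exists>\<nu>. is_eigenvector U (vkron \<nu> \<phi>) \<and>
            (\<forall>\<nu>'. is_eigenvector U (vkron \<nu>' \<phi>) \<longrightarrow> (\<exists>c. vkron \<nu>' \<phi> = c *s vkron \<nu> \<phi>)))"
proof -
  have "(\<lambda>\<rho>. ptrace_B (U ** kron \<rho> (outer \<phi> \<phi>) ** ctrans U)) = channel U \<phi>"
    by (simp add: channel_def fun_eq_iff)
  moreover from assms(7) have "ground_state_coupling (- MA) (- MB) U \<phi> (- lam)
      \<or> ground_state_coupling MA MB U \<phi> lam"
    using ground_state_coupling_negate[OF assms(2-6) _ assms(8)]
      ground_state_coupling.intro[OF assms(2-6) _ assms(8)] by blast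
  ultimately show ?thesis
    using ground_state_coupling.mixing_iff_unique_product_eigenvector by metis
qed

end
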